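(* Let $n\ge 1$ and $0\le m\le n$ be integers, and let $r_1>r_2>\cdots>r_m\ge 0$ and $s_{m+1}>\cdots>s_n\ge 0$ be sequences of non-negative integers such that $-r_j-\tfrac12\ne s_k+\tfrac12$ for all $1\le j\le m$ and $m+1\le k\le n$. Put $\mathbf r=(r_1,\dots,r_m)$, $\mathbf s=(s_{m+1},\dots,s_n)$, $r=\sum_{k=1}^m r_k$, $s=\sum_{k=m+1}^n s_k$, and let $G_{\mathbf r,\mathbf s}(q)$ be the coefficient of $t_1^{r_1+\frac12}\cdots t_m^{r_m+\frac12}\,t_{m+1}^{-s_{m+1}-\frac12}\cdots t_n^{-s_n-\frac12}$ in $F(t_1,\dots,t_n)$. Then, as $y\to0^+$, $$G_{\mathbf r,\mathbf s}\left(e^{-2\pi y}\right)=\frac1{2^n}\left(1-\pi\left(r-s+m+\frac{n(n-3)}4\right)y+O\left(y^2\right)\right).$$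
   Context: Fermionic Fock space: let $\psi(k+\tfrac12),\psi^*(k+\tfrac12)$, $k\in\mathbb Z$, satisfy $[\psi^*(\ell+\tfrac12),\psi(k+\tfrac12)]_+=\delta_{\ell+k+1,0}$ for $\ell,k\in\mathbb{Z}$, all other anticommutators being zero. $\mathcal F$ is the complex vector space generated from a vacuum vector $\mathbf 1$, annihilated by all $\psi(k+\tfrac12)$ and $\psi^*(k+\tfrac12)$ with $k\ge 0$, with basis the monomials $\psi(-n_a-\tfrac12)\cdots\psi(-n_1-\tfrac12)\psi^*(-m_b-\tfrac12)\cdots\psi^*(-m_1-\tfrac12)\mathbf 1$, where $n_a>\cdots>n_1\ge0$ and $m_b>\cdots>m_1\ge 0$. Such a monomial has charge $a-b$ and is an eigenvector of $L(0)$ with eigenvalue $\sum_i(n_i+\tfrac12)+\sum_i(m_i+\tfrac12)$. $\mathcal F_0$ is the span of the monomials of charge $0$. Let $A(t)=\sum_{\ell\in\mathbb Z}\psi^*(\ell+\tfrac12)\psi(-\ell-\tfrac12)\,t^{-\ell-\frac12}$, and define the Bloch-Okounkov $n$-point function (a formal series in the $t_j$, whose coefficients are power series in $q=e^{2\pi i\tau}$, $|q|<1$) by $$F(t_1,\dots,t_n)=\eta(\tau)\,\mathrm{tr}_{\mathcal F_0}A(t_1)\cdots A(t_n)\,q^{L(0)-\frac1{24}},\qquad \eta(\tau)=q^{\frac1{24}}\prod_{m\ge1}(1-q^m).$$ *)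

theory Defs
  imports
    "HOL-Analysis.Analysis"
    "HOL-Library.Landau_Symbols"
    "HOL-Library.Poly_Mapping"
    "HOL-Library.FSet"
begin

(* Poly_Mapping claims these binders, which would make suminf and prodinf ambiguous. *)
no_syntax
  "_Sum_any" :: "pttrn \<Rightarrow> 'a \<Rightarrow> 'a::comm_monoid_add"
    (\<open>(\<open>indent=2 notation=\<open>binder \<Sum>\<close>\<close>\<Sum>_. _)\<close> [0, 10] 10)
  "_Prod_any" :: "pttrn \<Rightarrow> 'a \<Rightarrow> 'a::comm_monoid_mult"
    (\<open>(\<open>indent=2 notation=\<open>binder \<Prod>\<close>\<close>\<Prod>_. _)\<close> [0, 10] 10)

text \<open>
  Half-integer modes are indexed by the integer below them: \<open>psi k\<close> and \<open>psis k\<close> are the operators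
  $\psi(k+1/2)$ and $\psi^*(k+1/2)$. In particular $\psi(-n-1/2)$ is \<open>psi (- int n - 1)\<close>.
\<close>

text \<open>
  For \<open>N = {n_1 < \<dots> < n_a}\<close> and \<open>M = {m_1 < \<dots> < m_b}\<close>, this is the monomial
  $\psi(-n_a-1/2)\cdots\psi(-n_1-1/2)\,\psi^*(-m_b-1/2)\cdots\psi^*(-m_1-1/2)\,\mathbf 1$:
  \<open>fold\<close> applies the operator with the smallest index first.
\<close>

definition fock_monomial ::
  "(int \<Rightarrow> 'v \<Rightarrow> 'v) \<Rightarrow> (int \<Rightarrow> 'v \<Rightarrow> 'v) \<Rightarrow> 'v \<Rightarrow> nat set \<times> nat set \<Rightarrow> 'v" where
  "fock_monomial psi psis vac = (\<lambda>(N, M).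
     fold (\<lambda>n. psi (- int n - 1)) (sorted_list_of_set N)
       (fold (\<lambda>m. psis (- int m - 1)) (sorted_list_of_set M) vac))"

definition fock_index :: "(nat set \<times> nat set) set" where
  "fock_index = {(N, M). finite N \<and> finite M}"

definition fock_charge :: "nat set \<times> nat set \<Rightarrow> int" where
  "fock_charge = (\<lambda>(N, M). int (card N) - int (card M))"

text \<open>The eigenvalue of $L(0)$ on a monomial.\<close>

definition fock_energy :: "nat set \<times> nat set \<Rightarrow> real" where
  "fock_energy = (\<lambda>(N, M). (\<Sum>n\<in>N. real n + 1/2) + (\<Sum>m\<in>M. real m + 1/2))"

text \<open>
  The Dedekind eta function, as a function of \<open>q = exp (2\<pi>i\<tau>)\<close>.
\<close>

definition eta_q :: "complex \<Rightarrow> complex" where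
  "eta_q q = q powr (1/24) * (\<Prod>m. 1 - q ^ Suc m)"

locale fermionic_fock_space = vector_space scale
  for scale :: "complex \<Rightarrow> 'v::ab_group_add \<Rightarrow> 'v" +
  fixes psi psis :: "int \<Rightarrow> 'v \<Rightarrow> 'v" and vac :: 'v
  assumes linear_psi: "Vector_Spaces.linear scale scale (psi k)"
    and linear_psis: "Vector_Spaces.linear scale scale (psis k)"
    and anticomm_psis_psi: "psis l (psi k v) + psi k (psis l v) = (if l + k + 1 = 0 then v else 0)"
    and anticomm_psi_psi: "psi l (psi k v) + psi k (psi l v) = 0"
    and anticomm_psis_psis: "psis l (psis k v) + psis k (psis l v) = 0"
    and psi_vac: "k \<ge> 0 \<Longrightarrow> psi k vac = 0"
    and psis_vac: "k \<ge> 0 \<Longrightarrow> psis k vac = 0"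
    and inj_monomial: "inj_on (fock_monomial psi psis vac) fock_index"
    and independent_monomials: "independent (fock_monomial psi psis vac ` fock_index)"
    and span_monomials: "span (fock_monomial psi psis vac ` fock_index) = UNIV"
begin

abbreviation monomial :: "nat set \<times> nat set \<Rightarrow> 'v" where
  "monomial \<equiv> fock_monomial psi psis vac"

text \<open>
  The trace over the charge-0 subspace of $T\,q^{L(0)-1/24}$, computed in the monomial basis:
  \<open>representation B v b\<close> is the coefficient of \<open>b\<close> in the expansion of \<open>v\<close> in the basis \<open>B\<close>.
  Energies of charge-0 monomials are integers, so after multiplication by \<open>eta_q q\<close>
  the choice of branch of the fractional powers of \<open>q\<close> is immaterial.
\<close>

definition charge0_trace :: "('v \<Rightarrow> 'v) \<Rightarrow> complex \<Rightarrow> complex" where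
  "charge0_trace T q =
     (\<Sum>\<^sub>\<infinity>p\<in>{p \<in> fock_index. fock_charge p = 0}.
        representation (monomial ` fock_index)
          (T (scale (q powr of_real (fock_energy p - 1/24)) (monomial p))) (monomial p))"

text \<open>
  The coefficient of $t^x$ in
  $A(t)=\sum_{\ell\in\mathbb Z}\psi^*(\ell+1/2)\psi(-\ell-1/2)\,t^{-\ell-1/2}$.
\<close>

definition A_coeff :: "real \<Rightarrow> 'v \<Rightarrow> 'v" where
  "A_coeff x =
     (if - x - 1/2 \<in> \<int> then (let l = \<lfloor>- x - 1/2\<rfloor> in psis l \<circ> psi (- l - 1)) else (\<lambda>v. 0))"

text \<open>
  The coefficient of $t_1^{x_1}\cdots t_n^{x_n}$ in $A(t_1)\cdots A(t_n)$; the variables being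
  distinct, this is a single composition.
\<close>

definition A_prod_coeff :: "nat \<Rightarrow> (nat \<Rightarrow> real) \<Rightarrow> 'v \<Rightarrow> 'v" where
  "A_prod_coeff n x = foldr (\<lambda>j T. A_coeff (x j) \<circ> T) [1..<n+1] id"

text \<open>
  The coefficient of $t_1^{x_1}\cdots t_n^{x_n}$ in the Bloch-Okounkov n-point function
  $F(t_1,\dots,t_n)$, as a function of \<open>q\<close>.
\<close>

definition npoint_coeff :: "nat \<Rightarrow> (nat \<Rightarrow> real) \<Rightarrow> complex \<Rightarrow> complex" where
  "npoint_coeff n x q = eta_q q * charge0_trace (A_prod_coeff n x) q"

end

text \<open>
  The coefficient of
  $t_1^{r_1+1/2}\cdots t_m^{r_m+1/2}\,t_{m+1}^{-s_{m+1}-1/2}\cdots t_n^{-s_n-1/2}$.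
\<close>

definition (in fermionic_fock_space) G_coeff ::
  "nat \<Rightarrow> nat \<Rightarrow> (nat \<Rightarrow> nat) \<Rightarrow> (nat \<Rightarrow> nat) \<Rightarrow> complex \<Rightarrow> complex" where
  "G_coeff n m r s =
     npoint_coeff n (\<lambda>j. if j \<le> m then real (r j) + 1/2 else - real (s j) - 1/2)"


subsection \<open>The axioms of the Fock space are satisfiable\<close>

text \<open>
  Finitely supported functions on finite sets of occupied modes; \<open>k < 0\<close> stands for
  \<open>psi k\<close> and \<open>k \<ge> 0\<close> for \<open>psis (- k - 1)\<close>. The relation \<open>before\<close> is the order in which
  these operators are applied in a monomial.
\<close>

type_synonym model = "int fset \<Rightarrow>\<^sub>0 complex"

definition before :: "int \<Rightarrow> int \<Rightarrow> bool" where
  "before x y \<longleftrightarrow> (0 \<le> x \<and> x < y) \<or> (0 \<le> x \<and> y < 0) \<or> (x < 0 \<and> y < x)"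

definition mode_sign :: "int \<Rightarrow> int fset \<Rightarrow> complex" where
  "mode_sign x S = (-1) ^ card {y. y |\<in>| S \<and> before x y}"

lift_definition model_scale :: "complex \<Rightarrow> model \<Rightarrow> model" is "\<lambda>c f S. c * f S"
  by (erule finite_subset[rotated]) auto

lift_definition create :: "int \<Rightarrow> model \<Rightarrow> model" is
  "\<lambda>x f S. if x |\<in>| S then mode_sign x S * f (S |-| {|x|}) else 0"
proof -
  fix x and f :: "int fset \<Rightarrow> complex" assume "finite {S. f S \<noteq> 0}"
  moreover have "{S. (if x |\<in>| S then mode_sign x S * f (S |-| {|x|}) else 0) \<noteq> 0}
      \<subseteq> finsert x ` {S. f S \<noteq> 0}"
  proof
    fix S assume "S \<in> {S. (if x |\<in>| S then mode_sign x S * f (S |-| {|x|}) else 0) \<noteq> 0}"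
    then have "x |\<in>| S" "f (S |-| {|x|}) \<noteq> 0" by (auto split: if_splits)
    then show "S \<in> finsert x ` {S. f S \<noteq> 0}"
      by (intro image_eqI[of _ _ "S |-| {|x|}"]) auto
  qed
  ultimately show "finite {S. (if x |\<in>| S then mode_sign x S * f (S |-| {|x|}) else 0) \<noteq> 0}"
    by (meson finite_imageI finite_subset)
qed

lift_definition annihilate :: "int \<Rightarrow> model \<Rightarrow> model" is
  "\<lambda>x f S. if x |\<in>| S then 0 else mode_sign x S * f (finsert x S)"
proof -
  fix x and f :: "int fset \<Rightarrow> complex" assume "finite {S. f S \<noteq> 0}"
  moreover have "{S. (if x |\<in>| S then 0 else mode_sign x S * f (finsert x S)) \<noteq> 0}
      \<subseteq> (\<lambda>S. S |-| {|x|}) ` {S. f S \<noteq> 0}"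
  proof
    fix S assume "S \<in> {S. (if x |\<in>| S then 0 else mode_sign x S * f (finsert x S)) \<noteq> 0}"
    then have "x |\<notin>| S" "f (finsert x S) \<noteq> 0" by (auto split: if_splits)
    then show "S \<in> (\<lambda>S. S |-| {|x|}) ` {S. f S \<noteq> 0}"
      by (intro image_eqI[of _ _ "finsert x S"]) auto
  qed
  ultimately show "finite {S. (if x |\<in>| S then 0 else mode_sign x S * f (finsert x S)) \<noteq> 0}"
    by (meson finite_imageI finite_subset)
qed

definition model_psi :: "int \<Rightarrow> model \<Rightarrow> model" where
  "model_psi k = (if k < 0 then create k else annihilate k)"

definition model_psis :: "int \<Rightarrow> model \<Rightarrow> model" where
  "model_psis k = (if k < 0 then create (- k - 1) else annihilate (- k - 1))"

definition state :: "int fset \<Rightarrow> model" where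
  "state S = Poly_Mapping.single S 1"

lemma before_iff: "x \<noteq> y \<Longrightarrow> before x y \<longleftrightarrow> \<not> before y x"
  unfolding before_def by auto

lemma not_before_self [simp]: "\<not> before x x"
  unfolding before_def by auto

lemma finite_before [simp]: "finite {y. y |\<in>| S \<and> before x y}"
  by (rule finite_subset[of _ "fset S"]) auto

lemma mode_sign_insert:
  "y |\<notin>| S \<Longrightarrow> mode_sign x (finsert y S) = (if before x y then - mode_sign x S else mode_sign x S)"
proof -
  assume y: "y |\<notin>| S"
  have "{z. z |\<in>| finsert y S \<and> before x z} =
      (if before x y then insert y {z. z |\<in>| S \<and> before x z} else {z. z |\<in>| S \<and> before x z})"
    by auto
  then show ?thesis using y by (simp add: mode_sign_def)
qed

lemma mode_sign_remove:
  "y |\<in>| S \<Longrightarrow>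
    mode_sign x (S |-| {|y|}) = (if before x y then - mode_sign x S else mode_sign x S)"
  using mode_sign_insert[of y "S |-| {|y|}" x] by (simp add: finsert_absorb split: if_splits)

lemma mode_sign_square [simp]: "mode_sign x S * (mode_sign x S * c) = c"
  by (simp add: mode_sign_def flip: power_add mult.assoc)

lemma create_create: "create x (create y v) + create y (create x v) = 0"
proof (rule poly_mapping_eqI)
  fix S
  have "S |-| {|x|} |-| {|y|} = S |-| {|y|} |-| {|x|}" by auto
  then show "Poly_Mapping.lookup (create x (create y v) + create y (create x v)) S
      = Poly_Mapping.lookup 0 S"
    using before_iff[of x y]
    by (cases "x = y") (auto simp: lookup_add create.rep_eq mode_sign_remove)
qed

lemma annihilate_annihilate: "annihilate x (annihilate y v) + annihilate y (annihilate x v) = 0"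
proof (rule poly_mapping_eqI)
  fix S
  have "finsert x (finsert y S) = finsert y (finsert x S)" by auto
  then show "Poly_Mapping.lookup (annihilate x (annihilate y v) + annihilate y (annihilate x v)) S
      = Poly_Mapping.lookup 0 S"
    using before_iff[of x y]
    by (cases "x = y"; cases "x |\<in>| S"; cases "y |\<in>| S")
      (simp_all add: lookup_add annihilate.rep_eq mode_sign_insert)
qed

lemma annihilate_create:
  "annihilate x (create y v) + create y (annihilate x v) = (if x = y then v else 0)"
proof (rule poly_mapping_eqI)
  fix S
  show "Poly_Mapping.lookup (annihilate x (create y v) + create y (annihilate x v)) S
      = Poly_Mapping.lookup (if x = y then v else 0) S"
  proof (cases "x = y")
    case True
    then show ?thesis
      by (cases "y |\<in>| S")
        (simp_all add: lookup_add annihilate.rep_eq create.rep_eq mode_sign_insert mode_sign_remove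
          finsert_absorb)
  next
    case False
    then have "finsert x S |-| {|y|} = finsert x (S |-| {|y|})" by auto
    then show ?thesis using False before_iff[of x y]
      by (cases "x |\<in>| S"; cases "y |\<in>| S")
        (simp_all add: lookup_add annihilate.rep_eq create.rep_eq mode_sign_insert mode_sign_remove)
  qed
qed

lemma vector_space_model: "vector_space model_scale"
  by unfold_locales
    (auto intro!: poly_mapping_eqI simp: model_scale.rep_eq lookup_add algebra_simps)

lemma linear_modes:
  "Vector_Spaces.linear model_scale model_scale (create x)"
  "Vector_Spaces.linear model_scale model_scale (annihilate x)"
  by (intro Vector_Spaces.linear_iff[THEN iffD2] conjI vector_space_model,
      auto intro!: poly_mapping_eqI
        simp: model_scale.rep_eq lookup_add create.rep_eq annihilate.rep_eq algebra_simps)+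

lemma create_state:
  assumes "x |\<notin>| S" "\<And>y. y |\<in>| S \<Longrightarrow> before y x"
  shows "create x (state S) = state (finsert x S)"
proof (rule poly_mapping_eqI)
  fix T
  have "{y. (y = x \<or> y |\<in>| S) \<and> before x y} = {}"
    using assms before_iff by auto metis
  then have sign: "mode_sign x (finsert x S) = 1"
    unfolding mode_sign_def by (simp only: finsert_iff card.empty power_0)
  have "T = finsert x S \<longleftrightarrow> x |\<in>| T \<and> T |-| {|x|} = S"
    using assms by auto
  then show "Poly_Mapping.lookup (create x (state S)) T
      = Poly_Mapping.lookup (state (finsert x S)) T"
    using sign by (auto simp: create.rep_eq state_def lookup_single when_def)
qed

definition occupied :: "nat set \<times> nat set \<Rightarrow> int set" where
  "occupied = (\<lambda>(N, M). (\<lambda>n. - int n - 1) ` N \<union> int ` M)"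

lemma fold_psis:
  "sorted_wrt (<) ms \<Longrightarrow>
    fold (\<lambda>m. model_psis (- int m - 1)) ms (state {||}) = state (Abs_fset (int ` set ms))"
proof (induction ms rule: rev_induct)
  case Nil
  then show ?case by (simp add: bot_fset_def)
next
  case (snoc m ms)
  let ?S = "Abs_fset (int ` set ms)"
  have fs: "fset ?S = int ` set ms" by (simp add: Abs_fset_inverse)
  have "create (int m) (state ?S) = state (finsert (int m) ?S)"
    using snoc.prems fs by (intro create_state) (auto simp: sorted_wrt_append before_def)
  moreover have "finsert (int m) ?S = Abs_fset (int ` set (ms @ [m]))"
    by (rule fset_inject[THEN iffD1]) (simp add: Abs_fset_inverse)
  ultimately show ?case
    using snoc by (simp add: sorted_wrt_append model_psis_def)
qed

lemma fold_psi:
  "sorted_wrt (<) ns \<Longrightarrow> finite M \<Longrightarrow>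
    fold (\<lambda>n. model_psi (- int n - 1)) ns (state (Abs_fset (int ` M)))
      = state (Abs_fset (occupied (set ns, M)))"
proof (induction ns rule: rev_induct)
  case Nil
  then show ?case by (simp add: occupied_def)
next
  case (snoc n ns)
  let ?S = "Abs_fset (occupied (set ns, M))"
  have fs: "fset ?S = occupied (set ns, M)"
    using snoc.prems by (simp add: Abs_fset_inverse occupied_def)
  have "create (- int n - 1) (state ?S) = state (finsert (- int n - 1) ?S)"
    using snoc.prems fs
    by (intro create_state) (auto simp: sorted_wrt_append before_def occupied_def)
  moreover have "finsert (- int n - 1) ?S = Abs_fset (occupied (set (ns @ [n]), M))"
    by (rule fset_inject[THEN iffD1])
      (use snoc.prems in \<open>simp add: Abs_fset_inverse occupied_def\<close>)
  ultimately show ?case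
    using snoc by (simp add: sorted_wrt_append model_psi_def)
qed

lemma model_monomial:
  "p \<in> fock_index \<Longrightarrow>
    fock_monomial model_psi model_psis (state {||}) p = state (Abs_fset (occupied p))"
  by (auto simp: fock_index_def fock_monomial_def fold_psis fold_psi)

lemma bij_occupied: "bij_betw (\<lambda>p. Abs_fset (occupied p)) fock_index UNIV"
proof (rule bij_betwI[where g = "\<lambda>S. ({n. - int n - 1 |\<in>| S}, {m. int m |\<in>| S})"])
  show "(\<lambda>S. ({n. - int n - 1 |\<in>| S}, {m. int m |\<in>| S})) \<in> UNIV \<rightarrow> fock_index"
  proof
    fix S :: "int fset"
    have "finite ((\<lambda>n. - int n - 1) -` fset S)" "finite (int -` fset S)"
      by (intro finite_vimageI; auto simp: inj_def)+
    then show "({n. - int n - 1 |\<in>| S}, {m. int m |\<in>| S}) \<in> fock_index"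
      by (simp add: fock_index_def vimage_def)
  qed
  show "Abs_fset (occupied ({n. - int n - 1 |\<in>| S}, {m. int m |\<in>| S})) = S" for S
  proof -
    have "occupied ({n. - int n - 1 |\<in>| S}, {m. int m |\<in>| S}) = fset S"
    proof (intro equalityI subsetI)
      fix k assume k: "k \<in> fset S"
      show "k \<in> occupied ({n. - int n - 1 |\<in>| S}, {m. int m |\<in>| S})"
      proof (cases "k < 0")
        case True
        then have "k = - int (nat (- k - 1)) - 1" by simp
        then show ?thesis using k unfolding occupied_def by fastforce
      next
        case False
        then have "k = int (nat k)" by simp
        then show ?thesis using k unfolding occupied_def by fastforce
      qed
    qed (auto simp: occupied_def)
    then show ?thesis by (simp add: fset_inverse)
  qed
qed (auto simp: fock_index_def occupied_def Abs_fset_inverse)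

theorem fermionic_fock_space_model:
  "fermionic_fock_space model_scale model_psi model_psis (state {||})"
proof -
  interpret vector_space model_scale by (rule vector_space_model)
  let ?mon = "fock_monomial model_psi model_psis (state {||})"
  have inj_state: "inj state"
    by (auto simp: inj_def state_def poly_mapping_eq_iff fun_eq_iff lookup_single when_def
        split: if_splits)
  have image: "?mon ` fock_index = range state"
  proof -
    have "?mon ` fock_index = state ` (\<lambda>p. Abs_fset (occupied p)) ` fock_index"
      by (auto simp: model_monomial image_iff)
    then show ?thesis using bij_occupied by (simp add: bij_betw_def)
  qed
  have coeff: "Poly_Mapping.lookup (\<Sum>v\<in>state ` X. model_scale (u v) v) S
      = (if S \<in> X then u (state S) else 0)"
    if "finite X" for X u S
  proof -
    have "Poly_Mapping.lookup (\<Sum>v\<in>state ` X. model_scale (u v) v) S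
        = (\<Sum>T\<in>X. u (state T) * Poly_Mapping.lookup (state T) S)"
      using inj_state
      by (simp add: sum.reindex inj_on_subset lookup_sum model_scale.rep_eq)
    also have "\<dots> = (\<Sum>T\<in>X. if T = S then u (state S) else 0)"
      by (intro sum.cong) (auto simp: state_def lookup_single when_def)
    finally show ?thesis using that by simp
  qed
  show ?thesis
  proof (intro fermionic_fock_space.intro fermionic_fock_space_axioms.intro vector_space_model)
    show "Vector_Spaces.linear model_scale model_scale (model_psi k)" for k
      by (simp add: model_psi_def linear_modes)
    show "Vector_Spaces.linear model_scale model_scale (model_psis k)" for k
      by (simp add: model_psis_def linear_modes)
    show "model_psis l (model_psi k v) + model_psi k (model_psis l v)
        = (if l + k + 1 = 0 then v else 0)" for l k v
      using create_create[of "- l - 1" k v] annihilate_annihilate[of "- l - 1" k v]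
        annihilate_create[of "- l - 1" k v] annihilate_create[of k "- l - 1" v]
      by (auto simp: model_psi_def model_psis_def add.commute split: if_splits)
    show "model_psi l (model_psi k v) + model_psi k (model_psi l v) = 0" for l k v
      using create_create[of l k v] annihilate_annihilate[of l k v]
        annihilate_create[of l k v] annihilate_create[of k l v]
      by (auto simp: model_psi_def add.commute split: if_splits)
    show "model_psis l (model_psis k v) + model_psis k (model_psis l v) = 0" for l k v
      using create_create[of "- l - 1" "- k - 1" v] annihilate_annihilate[of "- l - 1" "- k - 1" v]
        annihilate_create[of "- l - 1" "- k - 1" v] annihilate_create[of "- k - 1" "- l - 1" v]
      by (auto simp: model_psis_def add.commute split: if_splits)
    have "annihilate x (state {||}) = 0" for x
      by (rule poly_mapping_eqI) (auto simp: annihilate.rep_eq state_def lookup_single when_def)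
    then show "model_psi k (state {||}) = 0" "model_psis k (state {||}) = 0" if "k \<ge> 0" for k
      using that by (auto simp: model_psi_def model_psis_def)
    show "inj_on ?mon fock_index"
      using bij_occupied inj_state
      by (auto simp: inj_on_def bij_betw_def model_monomial inj_def)
    show "independent (?mon ` fock_index)"
      unfolding image independent_explicit_module
    proof (intro allI impI)
      fix t u v
      assume t: "finite t" "t \<subseteq> range state" "(\<Sum>v\<in>t. model_scale (u v) v) = 0" "v \<in> t"
      then obtain X where X: "t = state ` X" "finite X"
        by (meson finite_subset_image)
      then obtain S where "S \<in> X" "v = state S" using t by auto
      then show "u v = 0" using coeff[OF X(2), of u S] t(3) X by simp
    qed
    show "span (?mon ` fock_index) = UNIV"
      unfolding image
    proof (intro equalityI subsetI UNIV_I)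
      fix v :: model
      have "v = (\<Sum>w\<in>state ` Poly_Mapping.keys v.
            model_scale (Poly_Mapping.lookup v (inv state w)) w)"
        using inj_state
        by (intro poly_mapping_eqI) (auto simp: coeff in_keys_iff)
      also have "\<dots> \<in> span (range state)"
        by (intro span_sum span_scale span_base) auto
      finally show "v \<in> span (range state)" .
    qed
  qed
qed

hide_const (open) before mode_sign model_scale create annihilate model_psi model_psis state occupied

end

theory Submission
  imports Defs "HOL-Probability.Probability"
begin

text \<open>
  Write $q = e^{-h}$ with $h
      = 2\pi y$. Every coefficient of $A(t)$ is diagonal in the monomial basis,
  with eigenvalue 1 or 0 according to whether a mode $l$ is empty or not. Hence the coefficient in
  question is $\prod(1-q^m)$ times the partition function $U_0(\Lambda)$ of the charge-0 states in
      which a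
  set $\Lambda$ of $n$ modes is empty. Filling a mode gives the recursion
  $U_c(\Lambda)
      = U_c(\Lambda \cup \{l\})
      + q^{l+1/2}\, U_{c-1}(\Lambda \cup \{l\})$, and the Jacobi triple product
  identity gives $\prod(1-q^m)\, U_c(\emptyset)
      = q^{c^2/2}$, which is the characteristic function of a
  Gaussian variable $Z$. Therefore, up to a contour shift, the normalised $U_c(\Lambda)$ is
  $E[e^{-ic\theta} \prod_{l\in\Lambda} (1 + e^{i\theta} q^{l+1/2})^{-1}]$ with $\theta
      = \sqrt h\, Z$.
  Expanding the integrand in $\theta$ and $h$ and taking Gaussian moments gives the asymptotics; the
  blow-up of the integrand near $\theta = \pi$ is only polynomial in $1/h$ and is absorbed by
  higher moments.
\<close>

subsection \<open>Diagonal action of the coefficients\<close>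

text \<open>
  The modes of the Dirac sea are indexed by all integers \<open>l\<close>: mode \<open>l \<ge> 0\<close> is filled iff \<open>l \<in> N\<close>,
  and mode \<open>l < 0\<close> is filled iff the hole \<open>- l - 1\<close> is not in \<open>M\<close>. Filling mode \<open>l\<close> adds \<open>1\<close> to the
  charge and \<open>l + 1/2\<close> to the energy in both cases.
\<close>

definition mode_empty :: "int \<Rightarrow> nat set \<times> nat set \<Rightarrow> bool" where
  "mode_empty l = (\<lambda>(N, M). if l \<ge> 0 then nat l \<notin> N else nat (- l - 1) \<in> M)"

context fermionic_fock_space
begin

lemma double_eq_0:
  fixes v :: 'v assumes "v + v = 0" shows "v = 0"
proof -
  have "scale 2 v = v + v"
    using scale_left_distrib[of 1 1 v] by simp
  then have "scale 2 v = 0" using assms by simp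
  then show ?thesis by simp
qed

lemma psi_psi_self: "psi k (psi k v) = 0"
  using anticomm_psi_psi[of k k v] by (rule double_eq_0)

lemma psis_psis_self: "psis k (psis k v) = 0"
  using anticomm_psis_psis[of k k v] by (rule double_eq_0)

lemma psi_0: "psi k 0 = 0" and psi_minus: "psi k (- v) = - psi k v"
  and psi_diff: "psi k (v - w) = psi k v - psi k w"
  using linear_psi[of k]
  by (auto simp: module_hom.zero module_hom.neg module_hom.diff Vector_Spaces.linear_def)

lemma psis_0: "psis k 0 = 0" and psis_minus: "psis k (- v) = - psis k v"
  and psis_diff: "psis k (v - w) = psis k v - psis k w"
  using linear_psis[of k]
  by (auto simp: module_hom.zero module_hom.neg module_hom.diff Vector_Spaces.linear_def)

lemma psis_psi_vac: "psis l (psi (- l - 1) vac) = (if l \<ge> 0 then vac else 0)"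
proof (cases "l \<ge> 0")
  case True
  then show ?thesis using anticomm_psis_psi[of l "- l - 1" vac] by (simp add: psis_vac psi_0)
next
  case False
  then show ?thesis by (simp add: psi_vac psis_0)
qed

text \<open>Moving \<open>psis l\<close> and \<open>psi (- l - 1)\<close> past a different mode
  costs one sign each, and the signs cancel. Against \<open>psi (- l - 1)\<close> itself the result
  is 0 because a mode squares to 0.\<close>

lemma psis_psi_psi:
  "psis l (psi (- l - 1) (psi k v)) = (if k = - l - 1 then 0 else psi k (psis l (psi (- l - 1) v)))"
proof (cases "k = - l - 1")
  case True
  then show ?thesis by (simp add: psi_psi_self psis_0)
next
  case False
  have "psi (- l - 1) (psi k v) = - psi k (psi (- l - 1) v)"
    using anticomm_psi_psi by (rule eq_neg_iff_add_eq_0[THEN iffD2])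
  moreover have "psis l (psi k w) = - psi k (psis l w)" for w
    using anticomm_psis_psi[of l k w] False by (auto simp: eq_neg_iff_add_eq_0)
  ultimately show ?thesis using False by (simp add: psis_minus)
qed

text \<open>For \<open>k = l\<close> the anticommutator contributes the identity, and the other term
  contains \<open>psis l\<close> twice and vanishes. For other modes two signs cancel again.\<close>

lemma psis_psi_psis:
  "psis l (psi (- l - 1) (psis k v)) =
     (if k = l then psis k v else psis k (psis l (psi (- l - 1) v)))"
proof (cases "k = l")
  case True
  have "psi (- l - 1) (psis l v) = v - psis l (psi (- l - 1) v)"
    using anticomm_psis_psi[of l "- l - 1" v] by (simp add: algebra_simps)
  then show ?thesis using True by (simp add: psis_diff psis_psis_self)
next
  case False
  have "psi (- l - 1) (psis k v) = - psis k (psi (- l - 1) v)"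
    using anticomm_psis_psi[of k "- l - 1" v] False by (auto simp: eq_neg_iff_add_eq_0 add.commute)
  moreover have "psis l (psis k w) = - psis k (psis l w)" for w
    using anticomm_psis_psis by (rule eq_neg_iff_add_eq_0[THEN iffD2])
  ultimately show ?thesis using False by (simp add: psis_minus)
qed

lemma psis_psi_fold_psis:
  "psis l (psi (- l - 1) (fold (\<lambda>m. psis (- int m - 1)) ms vac)) =
     (if l \<ge> 0 \<or> nat (- l - 1) \<in> set ms then fold (\<lambda>m. psis (- int m - 1)) ms vac else 0)"
proof (induction ms rule: rev_induct)
  case Nil
  then show ?case by (simp add: psis_psi_vac)
next
  case (snoc m ms)
  have "- int m - 1 = l \<longleftrightarrow> l < 0 \<and> nat (- l - 1) = m" by auto
  then show ?case using snoc by (auto simp: psis_psi_psis psis_0)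
qed

text \<open>The eigenvalue on the inner vector is left abstract as \<open>P\<close>, so that the
  \<open>psi\<close> factors can be stacked on the \<open>psis\<close> factors already
  treated.\<close>

lemma psis_psi_fold_psi:
  assumes "psis l (psi (- l - 1) v) = (if P then v else 0)"
  shows "psis l (psi (- l - 1) (fold (\<lambda>n. psi (- int n - 1)) ns v)) =
     (if P \<and> \<not> (l \<ge> 0 \<and> nat l \<in> set ns) then fold (\<lambda>n. psi (- int n - 1)) ns v else 0)"
proof (induction ns rule: rev_induct)
  case Nil
  then show ?case by (simp add: assms)
next
  case (snoc n ns)
  have "- int n - 1 = - l - 1 \<longleftrightarrow> l \<ge> 0 \<and> nat l = n" by auto
  then show ?case using snoc by (auto simp: psis_psi_psi psi_0)
qed

lemma psis_psi_monomial:
  assumes "p \<in> fock_index"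
  shows "psis l (psi (- l - 1) (monomial p)) = (if mode_empty l p then monomial p else 0)"
proof -
  obtain N M where p: "p = (N, M)" "finite N" "finite M"
    using assms by (auto simp: fock_index_def)
  show ?thesis
    unfolding p fock_monomial_def
    by (simp add: psis_psi_fold_psi[OF psis_psi_fold_psis] mode_empty_def p)
qed

lemma A_coeff_eq: "A_coeff (- of_int l - 1/2) = psis l \<circ> psi (- l - 1)"
  by (simp add: A_coeff_def Let_def)

text \<open>Each factor has eigenvalue 0 or 1 on a monomial, so the product is the indicator that
  all listed modes are empty. Parametrising the exponents by the modes builds in that they are
  half-integers.\<close>

lemma foldr_psis_psi_scale_monomial:
  assumes "p \<in> fock_index"
  shows "foldr (\<lambda>j T. A_coeff (- of_int (l j) - 1/2) \<circ> T) js id (scale c (monomial p)) =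
    (if \<forall>j\<in>set js. mode_empty (l j) p then scale c (monomial p) else 0)"
proof (induction js)
  case (Cons j js)
  have "psis l (psi k (scale c v)) = scale c (psis l (psi k v))" for l k v
    using linear_psi[of k] linear_psis[of l]
    by (auto simp: module_hom.scale Vector_Spaces.linear_def)
  then show ?case using Cons assms
    by (simp add: A_coeff_eq psis_psi_monomial psi_0 psis_0)
qed simp

lemma npoint_coeff_eq:
  "npoint_coeff n (\<lambda>j. - of_int (l j) - 1/2) q = eta_q q *
     (\<Sum>\<^sub>\<infinity>p\<in>{p \<in> fock_index. fock_charge p = 0 \<and> (\<forall>j\<in>{1..n}. mode_empty (l j) p)}.
        q powr of_real (fock_energy p - 1/24))"
proof -
  have "representation (monomial ` fock_index)
          (A_prod_coeff n (\<lambda>j. - of_int (l j) - 1/2)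
            (scale (q powr of_real (fock_energy p - 1/24)) (monomial p))) (monomial p)
     = (if \<forall>j\<in>{1..n}. mode_empty (l j) p then q powr of_real (fock_energy p - 1/24) else 0)"
    if "p \<in> fock_index" for p
    using that
    by (simp add: A_prod_coeff_def foldr_psis_psi_scale_monomial representation_scale
      representation_basis representation_zero independent_monomials span_monomials
      atLeastLessThanSuc_atLeastAtMost del: upt_Suc)
  then show ?thesis
    unfolding npoint_coeff_def charge0_trace_def
    by (intro arg_cong2[where f = "(*)"] refl infsum_cong_neutral) auto
qed

end

subsection \<open>Filling and emptying modes\<close>

text \<open>Symmetric difference makes the map an involution, so a single map serves both for
  filling and for emptying a mode.\<close>

definition toggle_mode :: "int \<Rightarrow> nat set \<times> nat set \<Rightarrow> nat set \<times> nat set" where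
  "toggle_mode l
      = (\<lambda>(N, M). if l \<ge> 0 then (sym_diff N {nat l}, M) else (N, sym_diff M {nat (- l - 1)}))"

lemma toggle_mode_toggle_mode [simp]: "toggle_mode l (toggle_mode l p) = p"
  by (auto simp: toggle_mode_def split: prod.splits)

lemma toggle_mode_in_fock_index [simp]: "toggle_mode l p \<in> fock_index \<longleftrightarrow> p \<in> fock_index"
  by (auto simp: toggle_mode_def fock_index_def split: prod.splits)

lemma mode_empty_toggle_mode [simp]:
  "mode_empty k (toggle_mode l p) \<longleftrightarrow> (if k = l then \<not> mode_empty l p else mode_empty k p)"
  by (auto simp: toggle_mode_def mode_empty_def split: prod.splits)

lemma fock_charge_toggle_mode:
  assumes "p \<in> fock_index"
  shows "fock_charge (toggle_mode l p) = fock_charge p + (if mode_empty l p then 1 else - 1)"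
proof -
  obtain N M where p: "p = (N, M)" "finite N" "finite M"
    using assms by (auto simp: fock_index_def)
  have *: "int (card (sym_diff A {a})) = int (card A) + (if a \<in> A then - 1 else 1)"
    if "finite A" for A :: "nat set" and a
  proof (cases "a \<in> A")
    case True
    then have "sym_diff A {a} = A - {a}" by auto
    with True that show ?thesis
      by (simp add: card_Suc_Diff1[symmetric, of A a] del: card_Suc_Diff1 card_Diff_singleton
          card_Diff_insert)
  next
    case False
    then have "sym_diff A {a} = insert a A" by auto
    with False that show ?thesis by simp
  qed
  have "int (card A - Suc 0) = int (card A) - 1" if "finite A" "a \<in> A" for A :: "nat set" and a
    using that card_gt_0_iff[of A] by (auto simp: of_nat_diff)
  then show ?thesis using p by (auto simp: toggle_mode_def fock_charge_def mode_empty_def *)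
qed

lemma fock_energy_toggle_mode:
  assumes "p \<in> fock_index"
  shows "fock_energy (toggle_mode l p)
      = fock_energy p + (if mode_empty l p then 1 else - 1) * (of_int l + 1/2)"
proof -
  obtain N M where p: "p = (N, M)" "finite N" "finite M"
    using assms by (auto simp: fock_index_def)
  have *: "(\<Sum>n\<in>sym_diff A {a}. real n + 1/2)
      = (\<Sum>n\<in>A. real n + 1/2) + (if a \<in> A then - 1 else 1) * (real a + 1/2)"
    if "finite A" for A :: "nat set" and a
  proof (cases "a \<in> A")
    case True
    then have "sym_diff A {a} = A - {a}" by auto
    with True that show ?thesis by (simp add: sum_diff1)
  next
    case False
    then have "sym_diff A {a} = insert a A" by auto
    with False that show ?thesis by simp
  qed
  show ?thesis using p
      by (auto simp: toggle_mode_def fock_energy_def mode_empty_def * algebra_simps)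
qed

section \<open>Charge sectors and their truncation to finitely many modes\<close>

definition charge_states :: "int \<Rightarrow> (nat set \<times> nat set) set" where
  "charge_states c = {p \<in> fock_index. fock_charge p = c}"

definition boxed_states :: "nat \<Rightarrow> nat \<Rightarrow> int \<Rightarrow> (nat set \<times> nat set) set" where
  "boxed_states a b c = {p \<in> charge_states c. fst p \<subseteq> {..<a} \<and> snd p \<subseteq> {..<b}}"

lemma finite_boxed_states: "finite (boxed_states a b c)"
  by (rule finite_subset[of _ "Pow {..<a} \<times> Pow {..<b}"]) (auto simp: boxed_states_def)

lemma toggle_mode_in_charge_states:
  "toggle_mode l p \<in> charge_states c \<longleftrightarrow>
     p \<in> charge_states (if mode_empty l p then c - 1 else c + 1)"
  by (auto simp: charge_states_def fock_charge_toggle_mode)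

text \<open>The larger box has one new mode, \<open>int a\<close>. States with this mode empty lie
  in the old box; emptying it in the others lands in the old box with charge lowered by 1.\<close>

lemma boxed_states_Suc_left:
  "boxed_states (Suc a) b c = boxed_states a b c \<union> toggle_mode (int a) ` boxed_states a b (c - 1)"
  "boxed_states a b c \<inter> toggle_mode (int a) ` boxed_states a b (c - 1) = {}"
proof -
  have 1: "p \<in> boxed_states a b c \<longleftrightarrow> p \<in> boxed_states (Suc a) b c \<and> mode_empty (int a) p" for p c
    by (cases p) (auto simp: boxed_states_def mode_empty_def lessThan_Suc)
  have 2: "p \<in> toggle_mode (int a) ` boxed_states a b (c - 1) \<longleftrightarrow> toggle_mode (int a) p
      \<in> boxed_states a b (c - 1)" for p
    by (metis image_iff toggle_mode_toggle_mode)
  have 3: "fst (toggle_mode (int a) p) \<subseteq> {..<Suc a} \<longleftrightarrow> fst p \<subseteq> {..<Suc a}"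
    "snd (toggle_mode (int a) p) = snd p" for p
    by (cases p; auto simp: toggle_mode_def)+
  show "boxed_states (Suc a) b c
      = boxed_states a b c \<union> toggle_mode (int a) ` boxed_states a b (c - 1)"
    unfolding set_eq_iff Un_iff 2 1
    by (auto simp: boxed_states_def toggle_mode_in_charge_states 3)
  show "boxed_states a b c \<inter> toggle_mode (int a) ` boxed_states a b (c - 1) = {}"
    unfolding disjoint_iff 2 1 by simp
qed

text \<open>The new mode \<open>- int b - 1\<close> is filled in the old box, so the second set
  consists of the states with a new hole; a hole carries charge -1, whence
  \<open>c + 1\<close>.\<close>

lemma boxed_states_Suc_right:
  "boxed_states a (Suc b) c
      = boxed_states a b c \<union> toggle_mode (- int b - 1) ` boxed_states a b (c + 1)"
  "boxed_states a b c \<inter> toggle_mode (- int b - 1) ` boxed_states a b (c + 1) = {}"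
proof -
  have 1: "p \<in> boxed_states a b c \<longleftrightarrow> p
      \<in> boxed_states a (Suc b) c \<and> \<not> mode_empty (- int b - 1) p" for p c
    by (cases p) (auto simp: boxed_states_def mode_empty_def lessThan_Suc)
  have 2: "p \<in> toggle_mode (- int b - 1) ` boxed_states a b (c + 1) \<longleftrightarrow> toggle_mode (- int b - 1) p
      \<in> boxed_states a b (c + 1)" for p
    by (metis image_iff toggle_mode_toggle_mode)
  have 3: "snd (toggle_mode (- int b - 1) p) \<subseteq> {..<Suc b} \<longleftrightarrow> snd p \<subseteq> {..<Suc b}"
    "fst (toggle_mode (- int b - 1) p) = fst p" for p
    by (cases p; auto simp: toggle_mode_def)+
  show "boxed_states a (Suc b) c
      = boxed_states a b c \<union> toggle_mode (- int b - 1) ` boxed_states a b (c + 1)"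
    unfolding set_eq_iff Un_iff 2 1
    by (auto simp: boxed_states_def toggle_mode_in_charge_states 3)
  show "boxed_states a b c \<inter> toggle_mode (- int b - 1) ` boxed_states a b (c + 1) = {}"
    unfolding disjoint_iff 2 1 by simp
qed

lemma inj_toggle_mode: "inj_on (toggle_mode l) A"
  by (metis inj_onI toggle_mode_toggle_mode)

section \<open>Boltzmann weights and the finite triple product\<close>

definition boltzmann :: "real \<Rightarrow> nat set \<times> nat set \<Rightarrow> real" where
  "boltzmann h p = exp (- h * fock_energy p)"

lemma boltzmann_toggle_mode:
  assumes "p \<in> fock_index"
  shows "boltzmann h (toggle_mode l p) =
    exp (- h * (if mode_empty l p then 1 else - 1) * (of_int l + 1/2)) * boltzmann h p"
  using assms by (simp add: boltzmann_def fock_energy_toggle_mode algebra_simps flip: exp_add)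

lemma boxed_sum_Suc_left:
  "sum (boltzmann h) (boxed_states (Suc a) b c) = sum (boltzmann h) (boxed_states a b c)
     + exp (- h * (real a + 1/2)) * sum (boltzmann h) (boxed_states a b (c - 1))"
proof -
  have "sum (boltzmann h) (toggle_mode (int a) ` boxed_states a b (c - 1)) =
      (\<Sum>p\<in>boxed_states a b (c - 1). exp (- h * (real a + 1/2)) * boltzmann h p)"
    unfolding sum.reindex[OF inj_toggle_mode] o_def
    by (rule sum.cong)
       (auto simp: boltzmann_toggle_mode boxed_states_def charge_states_def mode_empty_def)
  then show ?thesis
    unfolding boxed_states_Suc_left(1)
    by (subst sum.union_disjoint)
        (auto simp: finite_boxed_states boxed_states_Suc_left(2) sum_distrib_left)
qed

lemma boxed_sum_Suc_right:
  "sum (boltzmann h) (boxed_states a (Suc b) c) = sum (boltzmann h) (boxed_states a b c)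
     + exp (- h * (real b + 1/2)) * sum (boltzmann h) (boxed_states a b (c + 1))"
proof -
  have "sum (boltzmann h) (toggle_mode (- int b - 1) ` boxed_states a b (c + 1)) =
      (\<Sum>p\<in>boxed_states a b (c + 1). exp (- h * (real b + 1/2)) * boltzmann h p)"
    unfolding sum.reindex[OF inj_toggle_mode] o_def
    by (rule sum.cong)
       (auto simp: boltzmann_toggle_mode boxed_states_def charge_states_def mode_empty_def
           algebra_simps)
  then show ?thesis
    unfolding boxed_states_Suc_right(1)
    by (subst sum.union_disjoint)
        (auto simp: finite_boxed_states boxed_states_Suc_right(2) sum_distrib_left)
qed

text \<open>The q-Pochhammer symbol \<open>(q; q)_k\<close> at \<open>q = exp (- h)\<close>.\<close>

definition euler_prod :: "real \<Rightarrow> nat \<Rightarrow> real" where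
  "euler_prod h k = (\<Prod>i<k. 1 - exp (- h) ^ Suc i)"

text \<open>
  With the value \<open>0\<close> at negative integers, the recursion \<open>euler_recip_minus_1\<close> holds for all
      integers,
  and no boundary cases arise in the induction over the box.
\<close>

definition euler_recip :: "real \<Rightarrow> int \<Rightarrow> real" where
  "euler_recip h k = (if k < 0 then 0 else 1 / euler_prod h (nat k))"

text \<open>At \<open>k = 0\<close> the factor \<open>1 - exp 0\<close> vanishes, in agreement with
  the value 0 at -1; for negative \<open>k\<close> both sides are 0.\<close>

lemma euler_recip_minus_1:
  assumes "h > 0"
  shows "euler_recip h (k - 1) = (1 - exp (- h * of_int k)) * euler_recip h k"
proof (cases "k \<le> 0")
  case True
  then show ?thesis by (auto simp: euler_recip_def)
next
  case False
  then obtain i where i: "k = int (Suc i)" by (metis not_le pos_int_cases Suc_pred)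
  have "1 - exp (- h) ^ Suc i \<noteq> 0"
    using assms power_less_one_iff[of "exp (- h)" "Suc i"] by simp
  moreover have "exp (- h * of_int k) = exp (- h) ^ Suc i"
    unfolding i exp_of_nat_mult[symmetric] by (simp add: algebra_simps)
  ultimately show ?thesis
    using i by (simp add: euler_recip_def euler_prod_def nat_add_distrib)
qed

text \<open>
  Up to the monomial factor this is the Gaussian binomial coefficient $[a+b,\, a-c]_q$, so the lemma
  is the finite form of the Jacobi triple product identity.
\<close>

lemma boxed_sum:
  assumes "h > 0"
  shows "sum (boltzmann h) (boxed_states a b c) =
    exp (- h * of_int c ^ 2 / 2) * euler_prod h (a + b) * euler_recip h (int a
        - c) * euler_recip h (int b + c)"
proof (induction a arbitrary: c)
  case 0
  show ?case
  proof (induction b arbitrary: c)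
    case 0
    have "boxed_states 0 0 c = (if c = 0 then {({}, {})} else {})"
      by (auto simp: boxed_states_def charge_states_def fock_index_def fock_charge_def)
    \<comment> \<open>For nonzero \<open>c\<close> one of the arguments \<open>- c\<close> and
      \<open>c\<close> is negative, so the right-hand side vanishes as well.\<close>
    then show ?case
      by (auto simp: boltzmann_def fock_energy_def euler_prod_def euler_recip_def)
  next
    case (Suc b)
    have 1: "euler_recip h (int b + c)
        = (1 - exp (- h * (real (Suc b) + of_int c))) * euler_recip h (int (Suc b) + c)"
      using euler_recip_minus_1[OF assms, of "int (Suc b) + c"] by simp
    have "- 1 - c = - c - 1" by simp
    then have 2: "euler_recip h (- 1 - c) = (1 - exp (h * of_int c)) * euler_recip h (- c)"
      using euler_recip_minus_1[OF assms, of "- c"] by (simp only:) simp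
    have 3: "euler_prod h (Suc b) = euler_prod h b * (1 - exp (- h * real (Suc b)))"
      by (simp add: euler_prod_def algebra_simps flip: exp_of_nat_mult exp_add)
    \<comment> \<open>Expanding the square: the energy of the new hole turns the Gaussian at
      \<open>c + 1\<close> into the Gaussian at \<open>c\<close> times the factor
      \<open>?x\<close>.\<close>
    have 4: "exp (- h * (of_int c + 1) ^ 2 / 2) * exp (- h * (real b + 1/2)) =
       exp (- h * of_int c ^ 2 / 2) * exp (- h * (real (Suc b) + of_int c))"
      unfolding exp_add[symmetric] by (simp add: field_simps power2_eq_square)
    have 5: "exp (- h * (real (Suc b) + of_int c)) * exp (h * of_int c) = exp (- h * real (Suc b))"
      by (simp add: algebra_simps flip: exp_add)
    let ?E = "exp (- h * of_int c ^ 2 / 2)" and ?x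
        = "exp (- h * (real (Suc b) + of_int c))" and ?y = "exp (h * of_int c)"
    have "sum (boltzmann h) (boxed_states 0 (Suc b) c) =
       ?E * euler_prod h b * euler_recip h (- c) * euler_recip h (int b + c) +
       (exp (- h * (of_int c + 1) ^ 2 / 2) * exp (- h * (real b + 1/2))) * euler_prod h b *
           euler_recip h (- 1 - c) * euler_recip h (int (Suc b) + c)"
      unfolding boxed_sum_Suc_right Suc by (simp add: algebra_simps)
    \<comment> \<open>The two terms combine by \<open>(1 - x) + x * (1 - y) = 1 - x * y\<close>, and
      \<open>x * y = q ^ Suc b\<close> supplies the factor missing from
      \<open>euler_prod h (Suc b)\<close>.\<close>
    also have "\<dots>
        = ?E * euler_prod h b * euler_recip h (- c) * euler_recip h (int (Suc b)
        + c) * (1 - ?x * ?y)"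
      unfolding 1 2 4 by (simp add: algebra_simps)
    finally show ?case unfolding 5 by (simp add: 3)
  qed
next
  case (Suc a)
  have 1: "euler_recip h (int a - c)
      = (1 - exp (- h * (real (Suc a) - of_int c))) * euler_recip h (int (Suc a) - c)"
    using euler_recip_minus_1[OF assms, of "int (Suc a) - c"] by (simp add: algebra_simps)
  have 2: "euler_recip h (int b + c - 1)
      = (1 - exp (- h * (real b + of_int c))) * euler_recip h (int b + c)"
    using euler_recip_minus_1[OF assms, of "int b + c"] by simp
  have 3: "euler_prod h (Suc a + b) = euler_prod h (a + b) * (1 - exp (- h * real (Suc a + b)))"
    by (simp add: euler_prod_def algebra_simps flip: exp_of_nat_mult exp_add)
  have 4: "exp (- h * (of_int c - 1) ^ 2 / 2) * exp (- h * (real a + 1/2)) =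
     exp (- h * of_int c ^ 2 / 2) * exp (- h * (real (Suc a) - of_int c))"
    unfolding exp_add[symmetric] by (simp add: field_simps power2_eq_square)
  have 5: "exp (- h * (real (Suc a) - of_int c)) * exp (- h * (real b + of_int c))
      = exp (- h * real (Suc a + b))"
    by (simp add: algebra_simps flip: exp_add)
  let ?E = "exp (- h * of_int c ^ 2 / 2)" and ?x = "exp (- h * (real (Suc a) - of_int c))" and ?y
      = "exp (- h * (real b + of_int c))"
  have "sum (boltzmann h) (boxed_states (Suc a) b c) =
     ?E * euler_prod h (a + b) * euler_recip h (int a - c) * euler_recip h (int b + c) +
     (exp (- h * (of_int c - 1) ^ 2 / 2) * exp (- h * (real a + 1/2))) * euler_prod h (a
         + b) * euler_recip h (int (Suc a) - c) * euler_recip h (int b + c - 1)"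
    unfolding boxed_sum_Suc_left Suc by (simp add: algebra_simps)
  \<comment> \<open>The same identity as in the induction over \<open>b\<close>; here
    \<open>x * y = q ^ (Suc a + b)\<close>.\<close>
  also have "\<dots>
      = ?E * euler_prod h (a + b) * euler_recip h (int (Suc a) - c) * euler_recip h (int b
      + c) * (1 - ?x * ?y)"
    unfolding 1 2 4 by (simp add: algebra_simps)
  finally show ?case unfolding 5 3 by simp
qed

subsection \<open>Partition functions with prescribed empty modes\<close>

text \<open>Euler's function, that is, the Dedekind eta function without its factor
  \<open>q powr (1/24)\<close>.\<close>

definition euler_phi :: "real \<Rightarrow> real" where
  "euler_phi h = (\<Prod>i. 1 - exp (- h) ^ Suc i)"

lemma euler_phi_has_prod:
  assumes "h > 0"
  shows "(\<lambda>i. 1 - exp (- h) ^ Suc i) has_prod euler_phi h"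
proof -
  have "summable (\<lambda>i. exp (- h) ^ Suc i)"
    using assms by (intro summable_Suc_iff[THEN iffD2] summable_geometric) simp
  then have "summable (\<lambda>i. \<bar>- (exp (- h) ^ Suc i)\<bar>)" by simp
  then have "convergent_prod (\<lambda>i. 1 + - (exp (- h) ^ Suc i))"
  proof (rule summable_imp_convergent_prod_real)
    show "- (exp (- h) ^ Suc i) \<noteq> - 1" for i
      using assms power_less_one_iff[of "exp (- h)" "Suc i"] by simp
  qed
  then show ?thesis unfolding euler_phi_def by (simp add: convergent_prod_has_prod del: power_Suc)
qed

lemma euler_phi_pos:
  assumes "h > 0"
  shows "euler_phi h > 0"
proof -
  have pos: "1 - exp (- h) ^ Suc i > 0" for i
    using assms by (simp add: power_less_one_iff del: power_Suc)
  have conv: "convergent_prod (\<lambda>i. 1 - exp (- h) ^ Suc i)"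
    using euler_phi_has_prod[OF assms] has_prod_iff by blast
  have "euler_phi h \<noteq> 0"
    unfolding euler_phi_def using pos by (intro prodinf_nonzero[OF conv]) (metis less_irrefl)
  moreover have "euler_phi h \<ge> 0"
    unfolding euler_phi_def using pos
    by (intro LIMSEQ_le_const[OF has_prod_imp_tendsto[OF convergent_prod_has_prod[OF conv]]]
          exI[of _ 0] allI impI prod_nonneg less_imp_le)
  ultimately show ?thesis by simp
qed

lemma euler_prod_LIMSEQ: "h > 0 \<Longrightarrow> euler_prod h \<longlonglongrightarrow> euler_phi h"
  using has_prod_imp_tendsto'[OF euler_phi_has_prod] by (simp add: euler_prod_def[abs_def])

lemma euler_recip_LIMSEQ:
  assumes "h > 0"
  shows "(\<lambda>n. euler_recip h (int n + c)) \<longlonglongrightarrow> 1 / euler_phi h"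
proof -
  have "filterlim (\<lambda>n. nat (int n + c)) at_top sequentially"
    unfolding filterlim_at_top
  proof
    fix k :: nat
    show "\<forall>\<^sub>F n in sequentially. k \<le> nat (int n + c)"
      using eventually_ge_at_top[of "nat (int k - c)"] by eventually_elim auto
  qed
  then have "(\<lambda>n. 1 / euler_prod h (nat (int n + c))) \<longlonglongrightarrow> 1 / euler_phi h"
    using euler_phi_pos[OF assms]
    by (intro tendsto_intros filterlim_compose[OF euler_prod_LIMSEQ] assms) auto
  moreover have "\<forall>\<^sub>F n in sequentially. 1 / euler_prod h (nat (int n + c))
      = euler_recip h (int n + c)"
    using eventually_ge_at_top[of "nat (- c)"] by eventually_elim (auto simp: euler_recip_def)
  ultimately show ?thesis by (rule Lim_transform_eventually)
qed

section \<open>The triple product in the limit of large boxes\<close>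

lemma boltzmann_nonneg: "boltzmann h p \<ge> 0"
  by (simp add: boltzmann_def)

text \<open>Let both sides of the box in \<open>boxed_sum\<close> grow. As the weights are
  nonnegative, the bounded box sums give summability, and the limit along boxes is then the
  unordered sum.\<close>

lemma boltzmann_has_sum:
  assumes "h > 0"
  shows "(boltzmann h has_sum exp (- h * of_int c ^ 2 / 2) / euler_phi h) (charge_states c)"
proof -
  let ?S = "\<lambda>n. boxed_states n n c"
  have lim: "(\<lambda>n. sum (boltzmann h) (?S n)) \<longlonglongrightarrow> exp (- h * of_int c ^ 2 / 2) / euler_phi h"
  proof -
    have "filterlim (\<lambda>n. n + n) at_top (sequentially :: nat filter)"
      by (rule filterlim_at_top_mono[OF filterlim_ident]) auto
    then have "(\<lambda>n. euler_prod h (n + n)) \<longlonglongrightarrow> euler_phi h"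
      by (rule filterlim_compose[OF euler_prod_LIMSEQ[OF assms]])
    \<comment> \<open>One of the two reciprocals cancels against the limit of
      \<open>euler_prod h (n + n)\<close>.\<close>
    then have "(\<lambda>n. sum (boltzmann h) (?S n)) \<longlonglongrightarrow>
        exp (- h * of_int c ^ 2 / 2) * euler_phi h * (1 / euler_phi h) * (1 / euler_phi h)"
      unfolding boxed_sum[OF assms]
      using euler_recip_LIMSEQ[OF assms, of "- c"] euler_recip_LIMSEQ[OF assms, of c]
      by (intro tendsto_intros) auto
    then show ?thesis using euler_phi_pos[OF assms] by simp
  qed
  have mono: "?S n \<subseteq> ?S k" if "n \<le> k" for n k
    using that by (auto simp: boxed_states_def)
  have exhaust: "\<exists>n. F \<subseteq> ?S n" if "finite F" "F \<subseteq> charge_states c" for F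
  proof -
    have "finite (\<Union>p\<in>F. fst p \<union> snd p)"
      using that by (auto simp: charge_states_def fock_index_def)
    then obtain n where "(\<Union>p\<in>F. fst p \<union> snd p) \<subseteq> {..<n}"
      by (meson finite_nat_iff_bounded)
    then have "F \<subseteq> ?S n" using that by (fastforce simp: boxed_states_def)
    then show ?thesis ..
  qed
  have le: "sum (boltzmann h) (?S n) \<le> exp (- h * of_int c ^ 2 / 2) / euler_phi h" for n
  proof (rule incseq_le[OF _ lim])
    show "incseq (\<lambda>n. sum (boltzmann h) (?S n))"
      by (intro incseq_SucI sum_mono2 finite_boxed_states mono) (auto simp: boltzmann_nonneg)
  qed
  have "bdd_above (sum (boltzmann h) ` {F. F \<subseteq> charge_states c \<and> finite F})"
  proof (rule bdd_aboveI2)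
    fix F assume "F \<in> {F. F \<subseteq> charge_states c \<and> finite F}"
    then obtain n where "F \<subseteq> ?S n" using exhaust by blast
    then have "sum (boltzmann h) F \<le> sum (boltzmann h) (?S n)"
      by (intro sum_mono2 finite_boxed_states) (auto simp: boltzmann_nonneg)
    with le show "sum (boltzmann h) F \<le> exp (- h * of_int c ^ 2 / 2) / euler_phi h"
      using order_trans by blast
  qed
  then have "boltzmann h summable_on charge_states c"
    by (intro nonneg_bdd_above_summable_on boltzmann_nonneg)
  then have "(boltzmann h has_sum infsum (boltzmann h) (charge_states c)) (charge_states c)"
    by (rule has_sum_infsum)
  \<comment> \<open>The square boxes eventually contain any given finite set of states, so they are
    cofinal among the finite subsets.\<close>
  moreover have "filterlim ?S (finite_subsets_at_top (charge_states c)) sequentially"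
    unfolding filterlim_finite_subsets_at_top
  proof (intro allI impI)
    fix F assume "finite F \<and> F \<subseteq> charge_states c"
    then obtain n where "F \<subseteq> ?S n" using exhaust by blast
    then have "\<forall>k\<ge>n. finite (?S k) \<and> F \<subseteq> ?S k \<and> ?S k \<subseteq> charge_states c"
      using mono finite_boxed_states by (fastforce simp: boxed_states_def)
    then show "\<forall>\<^sub>F k in sequentially. finite (?S k) \<and> F \<subseteq> ?S k \<and> ?S k \<subseteq> charge_states c"
      by (auto simp: eventually_sequentially)
  qed
  ultimately have "(\<lambda>n. sum (boltzmann h) (?S n)) \<longlonglongrightarrow> infsum (boltzmann h) (charge_states c)"
    unfolding has_sum_def by (rule filterlim_compose)
  then have "infsum (boltzmann h) (charge_states c) = exp (- h * of_int c ^ 2 / 2) / euler_phi h"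
    using lim LIMSEQ_unique by blast
  with \<open>(boltzmann h has_sum infsum _ _) _\<close> show ?thesis by simp
qed

text \<open>The factor \<open>euler_phi h\<close> is what remains of \<open>eta_q\<close> once its
  fractional power of \<open>q\<close> cancels against that of the trace. With it, the case of no
  prescribed modes is exactly Gaussian in the charge.\<close>

definition empty_sum :: "real \<Rightarrow> int set \<Rightarrow> int \<Rightarrow> real" where
  "empty_sum h \<Lambda> c =
     euler_phi h * (\<Sum>\<^sub>\<infinity>p\<in>{p \<in> charge_states c. \<forall>l\<in>\<Lambda>. mode_empty l p}. boltzmann h p)"

lemma boltzmann_summable:
  assumes "h > 0" "S \<subseteq> charge_states c"
  shows "boltzmann h summable_on S"
  using boltzmann_has_sum[OF assms(1)] assms(2) by (meson summable_on_def summable_on_subset_banach)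

lemma empty_sum_empty: "h > 0 \<Longrightarrow> empty_sum h {} c = exp (- h * of_int c ^ 2 / 2)"
  using euler_phi_pos[of h] infsumI[OF boltzmann_has_sum[of h c]] by (simp add: empty_sum_def)

lemma empty_sum_nonneg: "h > 0 \<Longrightarrow> empty_sum h \<Lambda> c \<ge> 0"
  unfolding empty_sum_def using euler_phi_pos[of h]
  by (intro mult_nonneg_nonneg infsum_nonneg boltzmann_nonneg) auto

lemma empty_sum_le:
  assumes "h > 0"
  shows "empty_sum h \<Lambda> c \<le> exp (- h * of_int c ^ 2 / 2)"
proof -
  have "empty_sum h \<Lambda> c \<le> empty_sum h {} c"
    unfolding empty_sum_def using assms euler_phi_pos[of h]
    by (intro mult_left_mono infsum_mono2 boltzmann_summable[of _ _ c])
        (auto simp: boltzmann_nonneg)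
  then show ?thesis by (simp add: empty_sum_empty assms)
qed

text \<open>Split the states according to whether mode \<open>l\<close> is empty. Emptying it in the
  remaining states lowers the charge by 1 and extracts the weight of the mode.\<close>

lemma empty_sum_insert:
  assumes "h > 0" "l \<notin> \<Lambda>"
  shows "empty_sum h (insert l \<Lambda>) c
      + exp (- h * (of_int l + 1/2)) * empty_sum h (insert l \<Lambda>) (c - 1)
    = empty_sum h \<Lambda> c"
proof -
  let ?A = "\<lambda>c. {p \<in> charge_states c. \<forall>k\<in>insert l \<Lambda>. mode_empty k p}"
  let ?B = "{p \<in> charge_states c. (\<forall>k\<in>\<Lambda>. mode_empty k p) \<and> \<not> mode_empty l p}"
  have "infsum (boltzmann h) ?B = (\<Sum>\<^sub>\<infinity>p\<in>?A (c - 1). exp (- h * (of_int l + 1/2)) * boltzmann h p)"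
  proof (rule infsum_reindex_bij_witness[where i = "toggle_mode l" and j = "toggle_mode l"])
    show "toggle_mode l p \<in> ?A (c - 1)" if "p \<in> ?B" for p
      using that assms(2) by (auto simp: toggle_mode_in_charge_states)
    show "toggle_mode l p \<in> ?B" if "p \<in> ?A (c - 1)" for p
      using that assms(2) by (auto simp: toggle_mode_in_charge_states)
    show "exp (- h * (of_int l + 1/2)) * boltzmann h (toggle_mode l p)
        = boltzmann h p" if "p \<in> ?B" for p
      using that by (simp add: boltzmann_toggle_mode charge_states_def flip: exp_add mult.assoc)
  qed auto
  also have "\<dots> = exp (- h * (of_int l + 1/2)) * infsum (boltzmann h) (?A (c - 1))"
    by (rule infsum_cmult_right')
  finally have B: "infsum (boltzmann h) ?B = \<dots>" .
  have "{p \<in> charge_states c. \<forall>k\<in>\<Lambda>. mode_empty k p} = ?A c \<union> ?B" by auto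
  moreover have "infsum (boltzmann h) (?A c \<union> ?B)
      = infsum (boltzmann h) (?A c) + infsum (boltzmann h) ?B"
    by (intro infsum_Un_disjoint boltzmann_summable[OF assms(1), of _ c]) auto
  ultimately show ?thesis
    unfolding empty_sum_def B by (simp add: algebra_simps)
qed

subsection \<open>Gaussian integral representation\<close>

lemma norm_one_plus_exp_ge: "1 - exp (Re z) \<le> norm (1 + exp z)"
  using norm_diff_ineq[of 1 "exp z"] by (simp add: norm_exp_eq_Re)

text \<open>A product of Fermi-Dirac factors with the contour shift \<open>L\<close> built in. The
  Fourier variable \<open>t\<close> is a general complex number, so that the product can later be
  expanded jointly in \<open>t\<close> and \<open>h\<close>.\<close>

definition fermi_prod :: "real \<Rightarrow> int set \<Rightarrow> complex \<Rightarrow> real \<Rightarrow> complex" where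
  "fermi_prod L \<Lambda> t h = (\<Prod>l\<in>\<Lambda>. 1 / (1 + exp (t - of_real (h * (of_int l + 1/2 + L)))))"

lemma one_plus_exp_nonzero: "Re z < 0 \<Longrightarrow> 1 + exp z \<noteq> (0 :: complex)"
  using norm_one_plus_exp_ge[of z] by auto

lemma norm_fermi_prod_le:
  assumes "h > 0" "Re t = 0" "\<And>l. l \<in> \<Lambda> \<Longrightarrow> of_int l + 1/2 + L > 0"
  shows "norm (fermi_prod L \<Lambda> t h) \<le> (\<Prod>l\<in>\<Lambda>. 1 / (1 - exp (- h * (of_int l + 1/2 + L))))"
  unfolding fermi_prod_def prod_norm[symmetric]
proof (rule prod_mono)
  fix l assume "l \<in> \<Lambda>"
  then have "h * (of_int l + 1/2 + L) > 0" using assms by simp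
  then show "0 \<le> norm (1 / (1 + exp (t - of_real (h * (of_int l + 1/2 + L))))) \<and>
     norm (1 / (1 + exp (t - of_real (h * (of_int l + 1/2 + L)))))
         \<le> 1 / (1 - exp (- h * (of_int l + 1/2 + L)))"
    using norm_one_plus_exp_ge[of "t - of_real (h * (of_int l + 1/2 + L))"] assms(2)
    by (auto simp: norm_divide intro!: divide_left_mono mult_pos_pos)
qed

lemma continuous_on_fermi_prod:
  assumes "h > 0" "\<And>l. l \<in> \<Lambda> \<Longrightarrow> of_int l + 1/2 + L > 0"
  shows "continuous_on UNIV (\<lambda>x. fermi_prod L \<Lambda> (\<i> * of_real (e * x)) h)"
  unfolding fermi_prod_def using assms
  by (intro continuous_intros ballI one_plus_exp_nonzero) auto

lemma integrable_std_normal_bounded: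
  fixes f :: "real \<Rightarrow> complex"
  assumes "continuous_on UNIV f" "\<And>x. norm (f x) \<le> B"
  shows "integrable std_normal_distribution f"
proof -
  interpret real_distribution std_normal_distribution by (rule real_dist_normal_dist)
  have "f \<in> borel_measurable borel" using assms(1) by (rule borel_measurable_continuous_onI)
  then show ?thesis using assms(2)
    by (intro integrable_const_bound[of _ B]) auto
qed

text \<open>
  The parameter \<open>L\<close> is the height to which the Fourier contour is shifted: the integrand has no
      poles as
  soon as \<open>l + 1/2 + L > 0\<close> for all \<open>l \<in> \<Lambda>\<close>, and the mean does not depend on \<open>L\<close> beyond that.
\<close>

definition gauss_mean :: "real \<Rightarrow> real \<Rightarrow> int set \<Rightarrow> int \<Rightarrow> complex" where
  "gauss_mean h L \<Lambda> c = exp (of_real (h * (of_int c * L + L\<^sup>2 / 2))) *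
     (LINT x|std_normal_distribution. exp (- of_real (of_int c + L) * (\<i> * of_real (sqrt h * x))) *
        fermi_prod L \<Lambda> (\<i> * of_real (sqrt h * x)) h)"

lemma integrable_gauss_mean:
  assumes "h > 0" "\<And>l. l \<in> \<Lambda> \<Longrightarrow> of_int l + 1/2 + L > 0"
  shows "integrable std_normal_distribution (\<lambda>x. exp (- of_real b * (\<i> * of_real (sqrt h * x))) *
        fermi_prod L \<Lambda> (\<i> * of_real (sqrt h * x)) h)"
proof (rule integrable_std_normal_bounded)
  show "continuous_on UNIV (\<lambda>x. exp (- of_real b * (\<i> * of_real (sqrt h * x))) *
        fermi_prod L \<Lambda> (\<i> * of_real (sqrt h * x)) h)"
    by (intro continuous_intros continuous_on_fermi_prod assms)
  show "norm (exp (- of_real b * (\<i> * of_real (sqrt h * x))) * fermi_prod L \<Lambda>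
      (\<i> * of_real (sqrt h * x)) h)
     \<le> (\<Prod>l\<in>\<Lambda>. 1 / (1 - exp (- h * (of_int l + 1/2 + L))))" for x
    using norm_fermi_prod_le[of h "\<i> * of_real (sqrt h * x)" \<Lambda> L] assms
    by (simp add: norm_mult norm_exp_eq_Re)
qed

text \<open>The integral is the characteristic function of the normal distribution at
  \<open>- (c + L) * sqrt h\<close>. The prefactor of \<open>gauss_mean\<close> is chosen to
  complete the square, which removes \<open>L\<close>.\<close>

lemma gauss_mean_empty:
  assumes "h > 0"
  shows "gauss_mean h L {} c = of_real (exp (- h * of_int c ^ 2 / 2))"
proof -
  have "(LINT x|std_normal_distribution. exp (- of_real (of_int c
      + L) * (\<i> * of_real (sqrt h * x))))
      = char std_normal_distribution (- (of_int c + L) * sqrt h)"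
    unfolding char_def by (intro Bochner_Integration.integral_cong refl arg_cong[where f
        = exp]) (simp add: algebra_simps)
  also have "\<dots> = of_real (exp (- h * (of_int c + L)\<^sup>2 / 2))"
    using assms
        by (simp add: char_std_normal_distribution power_mult_distrib mult.commute del:
        minus_add_distrib)
  finally have "gauss_mean h L {} c =
      of_real (exp (h * (of_int c * L + L\<^sup>2 / 2)) * exp (- h * (of_int c + L)\<^sup>2 / 2))"
    unfolding gauss_mean_def fermi_prod_def
        by (simp only: prod.empty mult_1_right exp_of_real) (simp only: of_real_mult)
  also have "exp (h * (of_int c * L + L\<^sup>2 / 2)) * exp (- h * (of_int c + L)\<^sup>2 / 2)
      = exp (- h * of_int c ^ 2 / 2)"
    unfolding exp_add[symmetric] by (simp add: field_simps power2_eq_square)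
  finally show ?thesis .
qed

text \<open>Multiplying the integrand by \<open>1 + ?u x\<close> cancels the Fermi factor of
  \<open>l\<close>, while the term with \<open>?u x\<close> is the integrand for charge
  \<open>c - 1\<close>.\<close>

lemma gauss_mean_insert:
  assumes "h > 0" "finite \<Lambda>" "l \<notin> \<Lambda>" "\<And>k. k \<in> insert l \<Lambda> \<Longrightarrow> of_int k + 1/2 + L > 0"
  shows "gauss_mean h L (insert l \<Lambda>) c
      + of_real (exp (- h * (of_int l + 1/2))) * gauss_mean h L (insert l \<Lambda>) (c - 1)
    = gauss_mean h L \<Lambda> c"
proof -
  let ?t = "\<lambda>x. \<i> * complex_of_real (sqrt h * x)"
  let ?E = "\<lambda>c x. exp (- complex_of_real (of_int c + L) * ?t x)"
  let ?F = "\<lambda>x. fermi_prod L (insert l \<Lambda>) (?t x) h"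
  let ?u = "\<lambda>x. exp (?t x - of_real (h * (of_int l + 1/2 + L)))"
  let ?G = "exp (complex_of_real (h * (of_int c * L + L\<^sup>2 / 2)))"
  \<comment> \<open>Lowering the charge changes the prefactor by \<open>exp (- h * L)\<close>, which
    moves the weight of mode \<open>l\<close> to the shifted contour.\<close>
  have a: "complex_of_real (exp (- h * (of_int l + 1/2))) * exp
      (of_real (h * (of_int (c - 1) * L + L\<^sup>2 / 2))) =
       ?G * exp (- of_real (h * (of_int l + 1/2 + L)))"
    by (simp add: algebra_simps flip: exp_of_real exp_add)
  have b: "?E (c - 1) x * exp (- of_real (h * (of_int l + 1/2 + L))) = ?E c x * ?u x" for x
    by (simp add: algebra_simps flip: exp_add)
  have int: "integrable std_normal_distribution (\<lambda>x. ?E c x * ?F x)" for c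
    by (rule integrable_gauss_mean) (use assms in auto)
  have "of_real (exp (- h * (of_int l + 1/2))) * gauss_mean h L (insert l \<Lambda>) (c - 1)
    = ?G * (exp (- of_real (h * (of_int l + 1/2 + L))) * (LINT x|std_normal_distribution. ?E (c
        - 1) x * ?F x))"
    unfolding gauss_mean_def mult.assoc[symmetric] a ..
  also have "\<dots>
      = ?G * (LINT x|std_normal_distribution. exp (- of_real (h * (of_int l + 1/2 + L))) *
      (?E (c - 1) x * ?F x))"
    by simp
  also have "(\<lambda>x. exp (- of_real (h * (of_int l + 1/2 + L))) * (?E (c - 1) x * ?F x))
      = (\<lambda>x. ?E c x * ?u x * ?F x)"
    unfolding b[symmetric] by (simp add: mult_ac)
  finally have c: "of_real (exp (- h * (of_int l + 1/2))) * gauss_mean h L (insert l \<Lambda>) (c - 1) =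
    ?G * (LINT x|std_normal_distribution. ?E c x * ?u x * ?F x)" .
  have int': "integrable std_normal_distribution (\<lambda>x. ?E c x * ?u x * ?F x)"
    using integrable_mult_right[OF int[of "c - 1"], of "exp (- of_real (h * (of_int l + 1/2 + L)))"]
    unfolding b[symmetric] by (simp add: mult_ac)
  have d: "?E c x * ?F x + ?E c x * ?u x * ?F x = ?E c x * fermi_prod L \<Lambda> (?t x) h" for x
  proof -
    have "1 + ?u x \<noteq> 0"
      by (rule one_plus_exp_nonzero) (use assms in simp)
    then have "(1 + ?u x) * ?F x = fermi_prod L \<Lambda> (?t x) h"
      using assms(2,3) by (simp add: fermi_prod_def)
    moreover have "?E c x * ?F x + ?E c x * ?u x * ?F x = ?E c x * ((1 + ?u x) * ?F x)"
      by (simp only: distrib_left distrib_right mult_1_left mult.assoc)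
    ultimately show ?thesis by (simp only:)
  qed
  show ?thesis
    unfolding c unfolding gauss_mean_def distrib_left[symmetric]
    by (simp only: Bochner_Integration.integral_add[OF int int', symmetric] d)
qed

text \<open>The charge enters the bound only through \<open>exp (h * c * L)\<close>; this controls
  the growth as \<open>c\<close> tends to minus infinity.\<close>

lemma norm_gauss_mean_le:
  assumes "h > 0" "\<And>l. l \<in> \<Lambda> \<Longrightarrow> of_int l + 1/2 + L > 0"
  shows "norm (gauss_mean h L \<Lambda> c)
      \<le> exp (h * (of_int c * L + L\<^sup>2 / 2)) * (\<Prod>l\<in>\<Lambda>. 1 / (1 - exp (- h * (of_int l + 1/2 + L))))"
proof -
  interpret real_distribution std_normal_distribution by (rule real_dist_normal_dist)
  let ?f = "\<lambda>x. exp (- of_real (of_int c + L) * (\<i> * of_real (sqrt h * x))) *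
        fermi_prod L \<Lambda> (\<i> * of_real (sqrt h * x)) h"
  let ?B = "(\<Prod>l\<in>\<Lambda>. 1 / (1 - exp (- h * (of_int l + 1/2 + L))))"
  have "norm (LINT x|std_normal_distribution. ?f x) \<le> (LINT x|std_normal_distribution. norm (?f x))"
    by (rule integral_norm_bound)
  also have "\<dots> \<le> (LINT x|std_normal_distribution. ?B)"
  proof (rule integral_mono)
    show "integrable std_normal_distribution (\<lambda>x. norm (?f x))"
      by (intro integrable_norm integrable_gauss_mean assms)
    show "norm (?f x) \<le> ?B" for x
      using norm_fermi_prod_le[of h "\<i> * of_real (sqrt h * x)" \<Lambda> L] assms
      by (simp add: norm_mult norm_exp_eq_Re)
  qed auto
  also have "\<dots> = ?B" using prob_space by simp
  finally show ?thesis unfolding gauss_mean_def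
    by (simp add: norm_mult norm_exp_eq_Re)
qed

text \<open>
  Both sides satisfy the same recursion, which determines them up to a multiple of
  $(-1)^c e^{-hxc}$ with $x = l + 1/2$; their growth as $c \to -\infty$ excludes such a term.
\<close>

lemma empty_sum_eq_gauss_mean:
  assumes h: "h > 0" and "finite \<Lambda>" "\<And>l. l \<in> \<Lambda> \<Longrightarrow> of_int l + 1/2 + L > 0"
  shows "of_real (empty_sum h \<Lambda> c) = gauss_mean h L \<Lambda> c"
  using assms(2,3)
proof (induction arbitrary: c rule: finite_induct)
  case empty
  then show ?case using h by (simp add: empty_sum_empty gauss_mean_empty)
next
  case (insert l \<Lambda>)
  let ?\<Lambda> = "insert l \<Lambda>"
  define d where "d c = of_real (empty_sum h ?\<Lambda> c) - gauss_mean h L ?\<Lambda> c" for c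
  define x where "x = of_int l + (1/2 :: real)"
  have "x + L > 0" using insert.prems by (simp add: x_def)
  have step: "d c = - of_real (exp (- h * x)) * d (c - 1)" for c
  proof -
    have "complex_of_real (empty_sum h ?\<Lambda> c + exp (- h * x) * empty_sum h ?\<Lambda> (c - 1)) =
       gauss_mean h L ?\<Lambda> c + of_real (exp (- h * x)) * gauss_mean h L ?\<Lambda> (c - 1)"
      using gauss_mean_insert[OF h insert.hyps, of L c] insert.IH[of c] insert.prems
      unfolding x_def empty_sum_insert[OF h insert.hyps(2)] by simp
    then show ?thesis unfolding d_def by (simp add: algebra_simps)
  qed
  have iter: "norm (d c) = exp (- h * x) ^ k * norm (d (c - int k))" for k
  proof (induction k)
    case (Suc k)
    then show ?case using step[of "c - int k"] by (simp add: norm_mult algebra_simps)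
  qed simp
  define B where "B = (1 + (\<Prod>l\<in>?\<Lambda>. 1 / (1 - exp (- h * (of_int l + 1/2 + L)))))"
  have bound: "norm (d c) \<le> exp (h * (of_int c * L + L\<^sup>2 / 2)) * B" for c
  proof -
    \<comment> \<open>Completing the square puts the Gaussian bound on \<open>empty_sum\<close>
      under the same exponential as the bound on \<open>gauss_mean\<close>.\<close>
    have "- h * of_int c ^ 2 / 2 \<le> h * (of_int c * L + L\<^sup>2 / 2)"
    proof -
      have "h * (of_int c + L)\<^sup>2 \<ge> 0" using h by simp
      then show ?thesis by (simp add: power2_eq_square algebra_simps)
    qed
    then have "empty_sum h ?\<Lambda> c \<le> exp (h * (of_int c * L + L\<^sup>2 / 2))"
      using empty_sum_le[OF h, of ?\<Lambda> c] by (meson exp_le_cancel_iff order_trans)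
    then have "norm (complex_of_real (empty_sum h ?\<Lambda> c)) \<le> exp (h * (of_int c * L + L\<^sup>2 / 2))"
      using empty_sum_nonneg[OF h, of ?\<Lambda> c] by simp
    then show ?thesis
      using norm_gauss_mean_le[OF h, of ?\<Lambda> L c] insert.prems
        norm_triangle_ineq4[of "complex_of_real (empty_sum h ?\<Lambda> c)" "gauss_mean h L ?\<Lambda> c"]
      unfolding d_def B_def distrib_left by simp
  qed
  \<comment> \<open>Going down \<open>k\<close> charges yields \<open>exp (- h * x) ^ k\<close> from
    the recursion and \<open>exp (- h * L) ^ k\<close> from the bound. Since
    \<open>x + L > 0\<close>, the product tends to 0.\<close>
  have "norm (d c) \<le> exp (h * (of_int c * L + L\<^sup>2 / 2)) * B * exp (- h * (x + L)) ^ k" for k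
  proof -
    have "norm (d c) \<le> exp (- h * x) ^ k * (exp (h * (of_int (c - int k) * L + L\<^sup>2 / 2)) * B)"
      unfolding iter[of k] by (intro mult_left_mono bound) auto
    also have "\<dots> = exp (h * (of_int c * L + L\<^sup>2 / 2)) * B * exp (- h * (x + L)) ^ k"
      by (simp add: algebra_simps flip: exp_of_nat_mult exp_add)
    finally show ?thesis .
  qed
  moreover have "(\<lambda>k. exp (h * (of_int c * L + L\<^sup>2 / 2)) * B * exp (- h * (x + L)) ^ k) \<longlonglongrightarrow>
      exp (h * (of_int c * L + L\<^sup>2 / 2)) * B * 0"
    using h \<open>x + L > 0\<close> by (intro tendsto_intros LIMSEQ_power_zero) simp
  ultimately have "norm (d c) \<le> 0"
    by (intro LIMSEQ_le_const[of _ 0]) auto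
  then show ?case by (simp add: d_def)
qed

subsection \<open>Expansion under the Gaussian mean\<close>

abbreviation weight4 :: "complex \<times> real \<Rightarrow> complex" where
  "weight4 \<equiv> \<lambda>p. of_real (norm (fst p) ^ 4 + snd p ^ 2)"

text \<open>
  Expansion at the origin where \<open>t\<close> has weight 1 and \<open>h\<close> has weight 2, up to terms of weight 4. The
  coefficients in weight 3 need not be recorded, because these terms are odd in \<open>t\<close> and have
  Gaussian mean 0.
\<close>

definition expands :: "(complex \<Rightarrow> real \<Rightarrow> complex) \<Rightarrow> complex \<Rightarrow> complex \<Rightarrow> complex \<Rightarrow> bool" where
  "expands A c1 c2 d \<longleftrightarrow> (\<exists>c3 e. (\<lambda>p. A (fst p) (snd p) -
      (1 + c1 * fst p + c2 * fst p ^ 2 + d * of_real (snd p) + c3 * fst p ^ 3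
          + e * (fst p * of_real (snd p))))
      \<in> O[nhds 0](weight4))"

lemma continuous_bigo_1:
  fixes f :: "'a::t2_space \<Rightarrow> complex"
  assumes "isCont f a"
  shows "f \<in> O[nhds a](\<lambda>_. 1)"
proof (rule bigoI_tendsto)
  show "((\<lambda>x. f x / 1) \<longlongrightarrow> f a) (nhds a)"
    using isCont_tendsto_compose[OF assms filterlim_ident] by simp
qed auto

text \<open>A monomial in \<open>t\<close> and \<open>h\<close> of weight at least 4 is divisible by
  \<open>t^4\<close>, \<open>t^2 h\<close> or \<open>h^2\<close>, so remainders are collected in
  this form. The mixed term is bounded by the inequality of arithmetic and geometric means.\<close>

lemma weight4_bigo:
  assumes "isCont X 0" "isCont Y 0" "isCont Z 0"
  shows "(\<lambda>p. fst p ^ 4 * X p + (fst p ^ 2 * of_real (snd p)) * Y p + of_real (snd p) ^ 2 * Z p)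
      \<in> O[nhds 0](weight4)"
proof -
  have *: "norm (weight4 p) = norm (fst p) ^ 4 + snd p ^ 2" for p
    by (simp only: norm_of_real) (simp add: abs_of_nonneg)
  have "(\<lambda>p. fst p ^ 4) \<in> O[nhds 0](weight4)" "(\<lambda>p. of_real (snd p) ^ 2) \<in> O[nhds 0](weight4)"
    by (intro bigoI[of _ 1] always_eventually allI; unfold *; simp add: norm_power)+
  moreover have "(\<lambda>p. fst p ^ 2 * of_real (snd p)) \<in> O[nhds 0](weight4)"
  proof (intro bigoI[of _ 1] always_eventually allI, unfold *)
    fix p :: "complex \<times> real"
    have "0 \<le> (norm (fst p) ^ 2 - \<bar>snd p\<bar>)\<^sup>2" by simp
    then have "2 * (norm (fst p) ^ 2 * \<bar>snd p\<bar>) \<le> norm (fst p) ^ 4 + snd p ^ 2"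
      by (simp add: power2_diff flip: power_mult)
    moreover have "0 \<le> norm (fst p) ^ 2 * \<bar>snd p\<bar>" by simp
    ultimately have "norm (fst p) ^ 2 * \<bar>snd p\<bar> \<le> norm (fst p) ^ 4 + snd p ^ 2"
      by linarith
    then show "norm (fst p ^ 2 * of_real (snd p)) \<le> 1 * (norm (fst p) ^ 4 + snd p ^ 2)"
      by (simp add: norm_mult norm_power)
  qed
  ultimately have "(\<lambda>p. fst p ^ 4 * X p) \<in> O[nhds 0](weight4)"
    "(\<lambda>p. (fst p ^ 2 * of_real (snd p)) * Y p) \<in> O[nhds 0](weight4)"
    "(\<lambda>p. of_real (snd p) ^ 2 * Z p) \<in> O[nhds 0](weight4)"
    using landau_o.big.mult[of _ _ weight4 _ "\<lambda>_. 1"] assms[THEN continuous_bigo_1]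
    by (simp_all only: mult_1_right)
  then show ?thesis by (intro sum_in_bigo)
qed

lemma expands_mult:
  assumes "expands A a1 a2 a" "expands B b1 b2 b"
  shows "expands (\<lambda>t h. A t h * B t h) (a1 + b1) (a2 + b2 + a1 * b1) (a + b)"
proof -
  obtain a3 a4 where A: "(\<lambda>p. A (fst p) (snd p)
      - (1 + a1 * fst p + a2 * fst p ^ 2 + a * of_real (snd p) + a3 * fst p ^ 3
      + a4 * (fst p * of_real (snd p)))) \<in> O[nhds 0](weight4)"
    using assms(1) unfolding expands_def by auto
  obtain b3 b4 where B: "(\<lambda>p. B (fst p) (snd p)
      - (1 + b1 * fst p + b2 * fst p ^ 2 + b * of_real (snd p) + b3 * fst p ^ 3
      + b4 * (fst p * of_real (snd p)))) \<in> O[nhds 0](weight4)"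
    using assms(2) unfolding expands_def by auto
  define P where "P p = 1 + a1 * fst p + a2 * fst p ^ 2 + a * of_real (snd p) + a3 * fst p ^ 3
      + a4 * (fst p * of_real (snd p))" for p :: "complex \<times> real"
  define Q where "Q p = 1 + b1 * fst p + b2 * fst p ^ 2 + b * of_real (snd p) + b3 * fst p ^ 3
      + b4 * (fst p * of_real (snd p))" for p :: "complex \<times> real"
  define R where "R p = A (fst p) (snd p) - P p" for p
  define S where "S p = B (fst p) (snd p) - Q p" for p
  \<comment> \<open>\<open>X\<close>, \<open>Y\<close> and \<open>Z\<close> collect the terms of
    \<open>P * Q\<close> of weight at least 4, as multiples of \<open>t^4\<close>,
    \<open>t^2 h\<close> and \<open>h^2\<close>.\<close>
  define X where "X p
      = a1*b3 + a2*b2 + a3*b1 + fst p * (a2*b3 + a3*b2)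
      + fst p ^ 2 * (a3*b3)" for p :: "complex \<times> real"
  define Y where "Y p = a1*b4 + a4*b1 + a2*b + a*b2 + fst p * (a3*b + a*b3 + a2*b4 + a4*b2)
      + fst p ^ 2 * (a3*b4 + a4*b3)" for p :: "complex \<times> real"
  define Z where "Z p = a*b + fst p * (a*b4 + a4*b) + fst p ^ 2 * (a4*b4)" for p :: "complex \<times> real"
  have R: "R \<in> O[nhds 0](weight4)" and S: "S \<in> O[nhds 0](weight4)"
    using A B by (simp_all add: R_def[abs_def] S_def[abs_def] P_def Q_def)
  have cont: "isCont P 0" "isCont Q 0" "isCont X 0" "isCont Y 0" "isCont Z 0"
    unfolding P_def Q_def X_def Y_def Z_def by (intro continuous_intros)+
  have "isCont (\<lambda>p::complex\<times>real. of_real (norm (fst p) ^ 4 + snd p ^ 2) :: complex) 0"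
    by (intro continuous_intros)
  then have "weight4 \<in> O[nhds 0](\<lambda>_. 1)" by (rule continuous_bigo_1)
  then have S1: "S \<in> O[nhds 0](\<lambda>_. 1)" using S landau_o.big_trans by blast
  have "(\<lambda>p. R p * Q p) \<in> O[nhds 0](weight4)" "(\<lambda>p. P p * S p)
      \<in> O[nhds 0](weight4)" "(\<lambda>p. R p * S p) \<in> O[nhds 0](weight4)"
    using landau_o.big.mult[OF R cont(2)[THEN continuous_bigo_1]] landau_o.big.mult[OF
        cont(1)[THEN continuous_bigo_1] S]
      landau_o.big.mult[OF R S1] by simp_all
  then have "(\<lambda>p. R p * Q p + P p * S p + R p * S p
      + (fst p ^ 4 * X p + (fst p ^ 2 * of_real (snd p)) * Y p + of_real (snd p) ^ 2 * Z p))
      \<in> O[nhds 0](weight4)"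
    by (intro sum_in_bigo weight4_bigo cont)
  moreover have "R p * Q p + P p * S p + R p * S p
      + (fst p ^ 4 * X p + (fst p ^ 2 * of_real (snd p)) * Y p + of_real (snd p) ^ 2 * Z p) =
    A (fst p) (snd p) * B (fst p) (snd p)
        - (1 + (a1 + b1) * fst p + (a2 + b2 + a1 * b1) * fst p ^ 2 + (a + b) * of_real (snd p) +
     (a3 + b3 + a1*b2 + a2*b1) * fst p ^ 3
         + (a4 + b4 + a1*b + a*b1) * (fst p * of_real (snd p)))" for p
  proof -
    have "R p * Q p + P p * S p + R p * S p = A (fst p) (snd p) * B (fst p) (snd p) - P p * Q p"
      by (simp add: R_def S_def algebra_simps)
    moreover have "P p * Q p
        = fst p ^ 4 * X p + (fst p ^ 2 * of_real (snd p)) * Y p + of_real (snd p) ^ 2 * Z p +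
      (1 + (a1 + b1) * fst p + (a2 + b2 + a1 * b1) * fst p ^ 2 + (a + b) * of_real (snd p) +
     (a3 + b3 + a1*b2 + a2*b1) * fst p ^ 3 + (a4 + b4 + a1*b + a*b1) * (fst p * of_real (snd p)))"
      unfolding P_def Q_def X_def Y_def Z_def by algebra
    ultimately show ?thesis by simp
  qed
  ultimately show ?thesis unfolding expands_def by auto
qed

text \<open>The argument has no term of weight below 1, so its fourth power has weight at least 4
  and the cubic Taylor polynomial of \<open>f\<close> suffices.\<close>

lemma expands_compose_linear:
  assumes "(\<lambda>u. f u - (1 + a * u + b * u ^ 2 + c * u ^ 3)) \<in> O[nhds 0](\<lambda>u. u ^ 4)"
  shows "expands (\<lambda>t h. f (\<alpha> * t + \<beta> * of_real h)) (a * \<alpha>) (b * \<alpha>\<^sup>2) (a * \<beta>)"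
proof -
  let ?u = "\<lambda>p::complex \<times> real. \<alpha> * fst p + \<beta> * of_real (snd p)"
  have "isCont ?u 0" by (intro continuous_intros)
  then have "filterlim ?u (nhds 0) (nhds 0)"
    using isCont_tendsto_compose[OF _ filterlim_ident, of 0 ?u] by simp
  then have "(\<lambda>p. f (?u p) - (1 + a * ?u p + b * ?u p ^ 2 + c * ?u p ^ 3))
      \<in> O[nhds 0](\<lambda>p. ?u p ^ 4)"
    by (rule landau_o.big.compose[OF assms])
  also have "(\<lambda>p. ?u p ^ 4)
      = (\<lambda>p. fst p ^ 4 * \<alpha> ^ 4
      + (fst p ^ 2 * of_real (snd p)) * (4 * \<alpha> ^ 3 * \<beta> * fst p
      + 6 * \<alpha> ^ 2 * \<beta> ^ 2 * of_real (snd p))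
     + of_real (snd p) ^ 2 * (4 * \<alpha> * \<beta> ^ 3 * (fst p * of_real (snd p))
         + \<beta> ^ 4 * of_real (snd p) ^ 2))"
    by (rule ext) (simp add: power2_eq_square power3_eq_cube power4_eq_xxxx algebra_simps)
  also have "\<dots> \<in> O[nhds 0](weight4)"
    by (intro weight4_bigo continuous_intros)
  finally have 1: "(\<lambda>p. f (?u p) - (1 + a * ?u p + b * ?u p ^ 2 + c * ?u p ^ 3))
      \<in> O[nhds 0](weight4)" .
  \<comment> \<open>These are the terms of weight at least 4 in the square and the cube of the
    linear form.\<close>
  have 2: "(\<lambda>p. fst p ^ 4 * 0 + (fst p ^ 2 * of_real (snd p)) * (3 * c * \<alpha> ^ 2 * \<beta>) +
       of_real (snd p) ^ 2 * (b * \<beta> ^ 2 + 3 * c * \<alpha> * \<beta> ^ 2 * fst p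
           + c * \<beta> ^ 3 * of_real (snd p))) \<in> O[nhds 0](weight4)"
    by (intro weight4_bigo continuous_intros)
  have "(\<lambda>p. (f (?u p) - (1 + a * ?u p + b * ?u p ^ 2 + c * ?u p ^ 3)) +
     (fst p ^ 4 * 0 + (fst p ^ 2 * of_real (snd p)) * (3 * c * \<alpha> ^ 2 * \<beta>) +
       of_real (snd p) ^ 2 * (b * \<beta> ^ 2 + 3 * c * \<alpha> * \<beta> ^ 2 * fst p
           + c * \<beta> ^ 3 * of_real (snd p)))) \<in> O[nhds 0](weight4)"
    using 1 2 by (rule sum_in_bigo)
  moreover have "(f (?u p) - (1 + a * ?u p + b * ?u p ^ 2 + c * ?u p ^ 3)) +
     (fst p ^ 4 * 0 + (fst p ^ 2 * of_real (snd p)) * (3 * c * \<alpha> ^ 2 * \<beta>) +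
       of_real (snd p) ^ 2 * (b * \<beta> ^ 2 + 3 * c * \<alpha> * \<beta> ^ 2 * fst p
           + c * \<beta> ^ 3 * of_real (snd p))) =
    f (?u p) - (1 + a * \<alpha> * fst p + b * \<alpha>\<^sup>2 * fst p ^ 2 + a * \<beta> * of_real (snd p)
        + (c * \<alpha> ^ 3) * fst p ^ 3 + (2 * b * \<alpha> * \<beta>) * (fst p * of_real (snd p)))" for p
    by (simp add: power2_eq_square power3_eq_cube algebra_simps)
  ultimately show ?thesis unfolding expands_def by (simp only:) blast
qed

section \<open>Taylor expansions of the exponential and of the Fermi factor\<close>

lemma exp_minus_cubic_bigo:
  "(\<lambda>u::complex. exp u - (1 + 1 * u + (1/2) * u ^ 2 + (1/6) * u ^ 3)) \<in> O[nhds 0](\<lambda>u. u ^ 4)"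
proof (rule bigoI)
  have "\<forall>\<^sub>F u::complex in nhds 0. dist u 0 < 1"
    using eventually_nhds_metric by (metis zero_less_one)
  then show "\<forall>\<^sub>F u::complex in nhds 0. norm (exp u - (1 + 1 * u + (1/2) * u ^ 2 + (1/6) * u ^ 3))
      \<le> exp 1 * norm (u ^ 4)"
  proof eventually_elim
    case (elim u)
    have "(\<Sum>i\<le>3. u ^ i / fact i) = 1 + 1 * u + (1/2) * u ^ 2 + (1/6) * u ^ 3"
      by (simp add: eval_nat_numeral fact_numeral)
    then have "norm (exp u - (1 + 1 * u + (1/2) * u ^ 2 + (1/6) * u ^ 3))
        \<le> exp (norm u) * norm u ^ 4 / 6"
      using Taylor_exp_field[of u 3] by (simp add: fact_numeral)
    also have "\<dots> \<le> exp (norm u) * norm u ^ 4" by simp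
    also have "\<dots> \<le> exp 1 * norm u ^ 4"
      using elim by (intro mult_right_mono) auto
    finally show ?case by (simp add: norm_power)
  qed
qed

text \<open>The function is \<open>1 - tanh (u/2)\<close>, so the quadratic coefficient vanishes by
  oddness.\<close>

lemma fermi_minus_cubic_bigo:
  "(\<lambda>u::complex. 2 / (1 + exp u) - (1 + (- 1/2) * u + 0 * u ^ 2 + (1/24) * u ^ 3))
      \<in> O[nhds 0](\<lambda>u. u ^ 4)"
proof -
  define R where "R u = exp u - (1 + 1 * u + (1/2) * u ^ 2 + (1/6) * u ^ 3)" for u :: complex
  have R: "R \<in> O[nhds 0](\<lambda>u. u ^ 4)"
    using exp_minus_cubic_bigo by (simp add: R_def[abs_def])
  define Q where "Q u = 1 - u / 2 + u ^ 3 / 24" for u :: complex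
  \<comment> \<open>With \<open>T\<close> the cubic Taylor polynomial of \<open>exp\<close>,
    \<open>2 - (1 + T u) * Q u\<close> equals \<open>u ^ 4\<close> times this polynomial.\<close>
  have cont: "isCont (\<lambda>u. 1/24 - u/48 - u^2/144 :: complex) 0" "isCont Q 0" "isCont (\<lambda>u. 1 / (1
      + exp u) :: complex) 0"
    unfolding Q_def by (intro continuous_intros; simp)+
  have "(\<lambda>u. u ^ 4 * (1/24 - u/48 - u^2/144) - R u * Q u) \<in> O[nhds 0](\<lambda>u. u ^ 4)"
    using landau_o.big.mult[OF R cont(2)[THEN continuous_bigo_1]]
      landau_o.big.mult[OF landau_o.big_refl[of "\<lambda>u. u ^ 4" "nhds 0"] cont(1)[THEN
          continuous_bigo_1]]
    by (intro sum_in_bigo) simp_all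
  from landau_o.big.mult[OF this cont(3)[THEN continuous_bigo_1]]
  have "(\<lambda>u. (u ^ 4 * (1/24 - u/48 - u^2/144) - R u * Q u) * (1 / (1 + exp u)))
      \<in> O[nhds 0](\<lambda>u. u ^ 4)" by simp
  moreover have "\<forall>\<^sub>F u in nhds 0. (u ^ 4 * (1/24 - u/48 - u^2/144)
      - R u * Q u) * (1 / (1 + exp u)) =
    2 / (1 + exp u) - (1 + (- 1/2) * u + 0 * u ^ 2 + (1/24) * u ^ 3)"
  proof -
    have "((\<lambda>u. 1 + exp u) \<longlongrightarrow> 1 + exp (0::complex)) (nhds 0)"
      by (intro tendsto_intros filterlim_ident)
    then have "\<forall>\<^sub>F u in nhds 0. 1 + exp (u::complex) \<noteq> 0"
      by (rule tendsto_imp_eventually_ne) simp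
    then show ?thesis
    proof eventually_elim
      case (elim u)
      have "u ^ 4 * (1/24 - u/48 - u^2/144) - R u * Q u = 2 - (1 + exp u) * Q u"
        unfolding R_def Q_def
            by (simp add: field_simps power2_eq_square power3_eq_cube power4_eq_xxxx)
      then show ?case using elim by (simp add: Q_def diff_divide_distrib)
    qed
  qed
  ultimately show ?thesis by (subst (asm) landau_o.big.in_cong)
qed

text \<open>Each normalised factor has linear coefficient -1/2 and quadratic coefficient 0. Hence
  the quadratic coefficient of the product is 1/4 for each pair of modes.\<close>

lemma expands_fermi_prod:
  assumes "finite \<Lambda>"
  shows "expands (\<lambda>t h. 2 ^ card \<Lambda> * fermi_prod L \<Lambda> t h) (of_real (- real (card \<Lambda>) / 2))
     (of_real (real (card \<Lambda>) * (real (card \<Lambda>) - 1) / 8)) (of_real ((\<Sum>l\<in>\<Lambda>. of_int l + 1/2 + L) / 2))"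
  using assms
proof (induction rule: finite_induct)
  case empty
  have "(\<lambda>p. 0) \<in> O[nhds 0](weight4)" by simp
  then show ?case by (auto simp: expands_def fermi_prod_def intro!: exI[of _ 0])
next
  case (insert l \<Lambda>)
  let ?a = "of_int l + 1/2 + L" and ?n = "real (card \<Lambda>)"
  have f: "2 ^ card (insert l \<Lambda>) * fermi_prod L (insert l \<Lambda>) t h =
      2 / (1 + exp (1 * t + (- of_real ?a) * of_real h)) * (2 ^ card \<Lambda> * fermi_prod L \<Lambda> t h)" for
          t h
  proof -
    have "1 * t + (- of_real ?a) * of_real h = t - of_real (h * ?a)"
      by (simp add: algebra_simps)
    then show ?thesis
        unfolding fermi_prod_def prod.insert[OF insert.hyps] card_insert_disjoint[OF insert.hyps]
      by (simp only: power_Suc times_divide_eq_left times_divide_eq_right mult_1_left mult.assoc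
          mult.left_commute)
  qed
  have c: "of_real (- real (card (insert l \<Lambda>)) / 2) = - 1/2 * 1 + complex_of_real (- ?n / 2)"
    "of_real (real (card (insert l \<Lambda>)) * (real (card (insert l \<Lambda>)) - 1) / 8) =
       0 * 1\<^sup>2 + complex_of_real (?n * (?n - 1) / 8) + - 1/2 * 1 * of_real (- ?n / 2)"
    "of_real ((\<Sum>l\<in>insert l \<Lambda>. of_int l + 1/2 + L) / 2) =
       - 1/2 * - of_real ?a + complex_of_real ((\<Sum>l\<in>\<Lambda>. of_int l + 1/2 + L) / 2)"
    using insert.hyps by (simp_all add: field_simps)
  show ?case unfolding f c
    by (rule expands_mult[OF expands_compose_linear[OF fermi_minus_cubic_bigo] insert.IH])
qed

text \<open>The Fourier factor together with the prefactor of \<open>gauss_mean\<close>, both at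
  charge 0.\<close>

lemma expands_exp: "expands (\<lambda>t h. exp (- of_real L * t + of_real (L\<^sup>2 / 2) * of_real h))
   (- of_real L) (of_real (L\<^sup>2 / 2)) (of_real (L\<^sup>2 / 2))"
  using expands_compose_linear[OF exp_minus_cubic_bigo, of "- of_real L" "of_real (L\<^sup>2 / 2)"]
      by simp

section \<open>Gaussian moments and control of the remainder\<close>

lemma integrable_std_normal_poly: "integrable std_normal_distribution (\<lambda>x. complex_of_real (x ^ k))"
  by (intro integrable_of_real integrable_std_normal_distribution_moment)

text \<open>Since \<open>t\<close> is imaginary, \<open>t^2\<close> has mean \<open>- h\<close>,
  which is why \<open>c2\<close> enters with a minus sign; the odd powers of \<open>t\<close> have
  mean 0.\<close>

lemma std_normal_cubic_mean:
  fixes c1 c2 c3 d e :: complex and h :: real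
  assumes "h \<ge> 0"
  defines "t \<equiv> \<lambda>x. \<i> * complex_of_real (sqrt h * x)"
  defines "P \<equiv> \<lambda>x. 1 + c1 * t x + c2 * t x ^ 2 + d * of_real h + c3 * t x ^ 3
      + e * (t x * of_real h)"
  shows "integrable std_normal_distribution P"
    and "(LINT x|std_normal_distribution. P x) = 1 + (d - c2) * of_real h"
proof -
  let ?s = "complex_of_real (sqrt h)"
  interpret real_distribution std_normal_distribution by (rule real_dist_normal_dist)
  have s2: "?s ^ 2 = of_real h" using assms by (simp flip: of_real_power)
  have P: "P = (\<lambda>x. (1 + d * of_real h) + (c1 * \<i> * ?s + e * \<i> * ?s * of_real h) * of_real (x ^ 1)
     + (- c2 * of_real h) * of_real (x ^ 2) + (- c3 * \<i> * ?s ^ 3) * of_real (x ^ 3))"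
    unfolding P_def t_def s2[symmetric]
    by (simp add: power_mult_distrib algebra_simps power3_eq_cube power2_eq_square)
  have "(LINT x|std_normal_distribution. complex_of_real (x ^ 1)) = 0"
    "(LINT x|std_normal_distribution. complex_of_real (x ^ 3)) = 0"
    "(LINT x|std_normal_distribution. complex_of_real (x ^ 2)) = 1"
    unfolding integral_complex_of_real
    using std_normal_distribution_even_moments(1)[of 1]
      integral_std_normal_distribution_moment_odd[of 1]
          integral_std_normal_distribution_moment_odd[of 3]
    by simp_all
  then have m: "has_bochner_integral std_normal_distribution (\<lambda>x. complex_of_real (x ^ 1)) 0"
    "has_bochner_integral std_normal_distribution (\<lambda>x. complex_of_real (x ^ 2)) 1"
    "has_bochner_integral std_normal_distribution (\<lambda>x. complex_of_real (x ^ 3)) 0"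
    by (simp_all only: has_bochner_integral_iff integrable_std_normal_poly simp_thms)
  have const: "has_bochner_integral std_normal_distribution (\<lambda>x. 1 + d * of_real h) (1
      + d * of_real h)"
    using prob_space by (simp add: has_bochner_integral_iff)
  have "has_bochner_integral std_normal_distribution P
     ((1 + d * of_real h) + (c1 * \<i> * ?s + e * \<i> * ?s * of_real h) * 0
     + (- c2 * of_real h) * 1 + (- c3 * \<i> * ?s ^ 3) * 0)"
    unfolding P by (intro has_bochner_integral_add has_bochner_integral_mult_right m const)
  then show "integrable std_normal_distribution P"
      "(LINT x|std_normal_distribution. P x) = 1 + (d - c2) * of_real h"
    unfolding has_bochner_integral_iff by (auto simp: algebra_simps)
qed

text \<open>The error is bounded pointwise by \<open>h ^ 2\<close> times a polynomial in
  \<open>x\<close> that does not depend on \<open>h\<close>, and polynomials are integrable. Only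
  near the origin does this come from the expansion; elsewhere \<open>A\<close> and its polynomial
  are bounded separately.\<close>

lemma expands_std_normal_mean:
  assumes A: "expands A c1 c2 d"
    and cont: "\<And>h. 0 < h \<Longrightarrow> continuous_on UNIV (\<lambda>x. A (\<i> * of_real (sqrt h * x)) h)"
    and bound: "\<And>h x. 0 < h \<Longrightarrow> h < 1 \<Longrightarrow> norm (A (\<i> * of_real x) h) \<le> K / h ^ N"
  shows "(\<lambda>h. (LINT x|std_normal_distribution. A (\<i> * of_real (sqrt h * x)) h)
      - (1 + (d - c2) * of_real h))
     \<in> O[at_right 0](\<lambda>h. of_real (h ^ 2))"
proof -
  obtain c3 e where "(\<lambda>p. A (fst p) (snd p) -
      (1 + c1 * fst p + c2 * fst p ^ 2 + d * of_real (snd p) + c3 * fst p ^ 3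
          + e * (fst p * of_real (snd p))))
      \<in> O[nhds 0](weight4)" (is "?R \<in> _")
    using A unfolding expands_def by blast
  then obtain C where C: "C > 0" "\<forall>\<^sub>F p in nhds 0. norm (?R p) \<le> C * norm (weight4 p)"
    by (rule landau_o.bigE)
  define P where "P t h
      = 1 + c1 * t + c2 * t ^ 2 + d * of_real h + c3 * t ^ 3
      + e * (t * of_real h)" for t :: complex and h :: real
  obtain \<delta>' where \<delta>': "\<delta>' > 0" "\<And>p. dist p 0 < \<delta>' \<Longrightarrow> norm (?R p) \<le> C * norm (weight4 p)"
    using C(2) unfolding eventually_nhds_metric by blast
  \<comment> \<open>Half of the radius goes to each component of the pair \<open>(t, h)\<close>; the
    bound 1 ensures \<open>h < 1\<close>, as \<open>bound\<close> and \<open>far\<close>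
    require.\<close>
  define \<delta> where "\<delta> = min 1 (\<delta>' / 2)"
  have \<delta>: "0 < \<delta>" "\<delta> \<le> 1" using \<delta>' by (auto simp: \<delta>_def)
  have near: "norm (A t h - P t h) \<le> C * (norm t ^ 4 + h ^ 2)" if "norm t < \<delta>" "\<bar>h\<bar> < \<delta>" for t h
  proof -
    have "norm (t, h) \<le> norm t + norm h" by (rule norm_Pair_le)
    also have "\<dots> < \<delta>'" using that by (simp add: \<delta>_def)
    finally have "norm (?R (t, h)) \<le> C * norm (weight4 (t, h))" by (intro \<delta>') (simp add: dist_norm)
    then show ?thesis unfolding norm_of_real by (simp add: P_def abs_of_nonneg)
  qed
  define Q where "Q = 1 + norm c1 + norm c2 + norm d + norm c3 + norm e"
  have far: "norm (P t h) \<le> Q * (norm t / \<delta>) ^ 4" if "norm t \<ge> \<delta>" "0 < h" "h < 1" for t h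
  proof -
    let ?s = "norm t / \<delta>"
    have s: "?s \<ge> 1" using that \<delta> by simp
    have "norm t * \<delta> \<le> norm t * 1" using \<delta> by (intro mult_left_mono) auto
    then have "norm t \<le> ?s" using \<delta> by (simp add: field_simps)
    then have k: "norm t ^ k \<le> ?s ^ 4" if "k \<le> 4" for k
      using power_mono[of "norm t" ?s k] power_increasing[OF that s]
          by (meson norm_ge_zero order_trans)
    have 0: "1 \<le> ?s ^ 4" using k[of 0] by simp
    have 1: "norm t \<le> ?s ^ 4" using k[of 1] by simp
    have h: "h \<le> ?s ^ 4" "norm t * h \<le> ?s ^ 4"
      using 0 1 that mult_left_le[of h "norm t"] by auto
    have "norm (P t h)
        \<le> norm (1::complex) + norm (c1 * t) + norm (c2 * t ^ 2) + norm (d * of_real h)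
        + norm (c3 * t ^ 3) + norm (e * (t * of_real h))"
      unfolding P_def by (intro norm_triangle_mono order_refl)
    also have "\<dots> = 1 + norm c1 * norm t + norm c2 * norm t ^ 2 + norm d * h + norm c3 * norm t ^ 3
        + norm e * (norm t * h)"
      using that by (simp add: norm_mult norm_power)
    also have "\<dots> \<le> ?s ^ 4 + norm c1 * ?s ^ 4 + norm c2 * ?s ^ 4 + norm d * ?s ^ 4
        + norm c3 * ?s ^ 4 + norm e * ?s ^ 4"
      by (intro add_mono mult_left_mono 0 1 h k) auto
    finally show ?thesis by (simp add: Q_def algebra_simps)
  qed
  \<comment> \<open>The summands bound, in order, the difference near the origin, \<open>A\<close>
    away from it, and the polynomial away from it.\<close>
  define D where "D x = C * (1 + x ^ 4) + \<bar>K\<bar> / \<delta> ^ (2 * (N + 2)) * x ^ (2 * (N + 2))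
      + Q / \<delta> ^ 4 * x ^ 4" for x :: real
  have pos: "Q \<ge> 0" by (simp add: Q_def)
  have point: "norm (A (\<i> * of_real (sqrt h * x)) h - P (\<i> * of_real (sqrt h * x)) h) \<le> h ^ 2 * D x"
    if h: "0 < h" "h < \<delta>" for h x
  proof -
    let ?t = "\<i> * complex_of_real (sqrt h * x)"
    have t: "norm ?t = sqrt h * \<bar>x\<bar>" using h by (simp add: norm_mult abs_mult)
    \<comment> \<open>Even powers turn the square root of \<open>h\<close> into integral
      powers.\<close>
    have t2: "norm ?t ^ (2 * k) = h ^ k * x ^ (2 * k)" for k
      unfolding t power_mult using h by (simp add: power_mult_distrib)
    have nn: "0 \<le> x ^ 4" "0 \<le> x ^ (2 * (N + 2))" by (rule zero_le_even_power, simp)+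
    show ?thesis
    proof (cases "norm ?t < \<delta>")
      case True
      then have "norm (A ?t h - P ?t h) \<le> C * (norm ?t ^ (2 * 2) + h ^ 2)"
        using near[of ?t h] h by simp
      also have "\<dots> = h ^ 2 * (C * (1 + x ^ 4))" unfolding t2 by (simp add: algebra_simps)
      also have "\<dots> \<le> h ^ 2 * D x" unfolding D_def using nn pos \<delta> by (intro mult_left_mono) auto
      finally show ?thesis .
    next
      case False
      \<comment> \<open>Any power of \<open>norm t / \<delta>\<close> may be inserted here; one of them absorbs the factor \<open>h ^ N\<close>.\<close>
      have "1 \<le> norm ?t / \<delta>" using False \<delta> by simp
      then have one: "1 \<le> (norm ?t / \<delta>) ^ (2 * (N + 2))" by (rule one_le_power)
      have "norm (A ?t h) \<le> \<bar>K\<bar> / h ^ N"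
        using bound[of h "sqrt h * x"] h \<delta> by (smt (verit, best) divide_right_mono zero_le_power)
      also have "\<dots> \<le> \<bar>K\<bar> / h ^ N * (norm ?t / \<delta>) ^ (2 * (N + 2))"
        using mult_left_mono[OF one, of "\<bar>K\<bar> / h ^ N"] h by simp
      also have "\<dots> = \<bar>K\<bar> / h ^ N * (h ^ (N + 2) * x ^ (2 * (N + 2))) / \<delta> ^ (2 * (N + 2))"
        unfolding power_divide t2 by (simp only: times_divide_eq_right)
      also have "\<dots> = h ^ 2 * (\<bar>K\<bar> / \<delta> ^ (2 * (N + 2)) * x ^ (2 * (N + 2)))"
        using h by (simp add: power_add[of h N 2] power2_eq_square del: mult_Suc_right mult_2)
      finally have 1: "norm (A ?t h) \<le> \<dots>" .
      have "norm (P ?t h) \<le> Q * (norm ?t ^ (2 * 2) / \<delta> ^ 4)"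
        using far[of ?t h] False h \<delta> by (simp add: power_divide)
      also have "\<dots> = h ^ 2 * (Q / \<delta> ^ 4 * x ^ 4)" unfolding t2 by simp
      finally have 2: "norm (P ?t h) \<le> \<dots>" .
      have "norm (A ?t h - P ?t h)
          \<le> h ^ 2 * (\<bar>K\<bar> / \<delta> ^ (2 * (N + 2)) * x ^ (2 * (N + 2)) + Q / \<delta> ^ 4 * x ^ 4)"
        using norm_triangle_ineq4[of "A ?t h" "P ?t h"] 1 2 by (simp only: distrib_left)
      also have "\<dots> \<le> h ^ 2 * D x" unfolding D_def using nn C(1) by (intro mult_left_mono) auto
      finally show ?thesis .
    qed
  qed
  have intD: "integrable std_normal_distribution D"
  proof -
    interpret real_distribution std_normal_distribution by (rule real_dist_normal_dist)
    show ?thesis unfolding D_def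
      by (intro Bochner_Integration.integrable_add integrable_mult_right
          integrable_std_normal_distribution_moment integrable_const)
  qed
  show ?thesis
  proof (rule bigoI)
    have "\<forall>\<^sub>F h in at_right 0. 0 < h \<and> h < \<delta>"
      using \<delta>(1) by (auto simp: eventually_at_right_field)
    then show "\<forall>\<^sub>F h in at_right 0. norm
        ((LINT x|std_normal_distribution. A (\<i> * of_real (sqrt h * x)) h)
        - (1 + (d - c2) * of_real h))
       \<le> (LINT x|std_normal_distribution. D x) * norm (complex_of_real (h ^ 2))"
    proof eventually_elim
      case (elim h)
      let ?t = "\<lambda>x. \<i> * complex_of_real (sqrt h * x)"
      have intA: "integrable std_normal_distribution (\<lambda>x. A (?t x) h)"
        using elim \<delta> by (intro integrable_std_normal_bounded[of _ "K / h ^ N"] cont bound) auto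
      have intP: "integrable std_normal_distribution (\<lambda>x. P (?t x) h)"
        and P: "(LINT x|std_normal_distribution. P (?t x) h) = 1 + (d - c2) * of_real h"
        using std_normal_cubic_mean[of h c1 c2 d c3 e] elim unfolding P_def by simp_all
      have "norm ((LINT x|std_normal_distribution. A (?t x) h) - (1 + (d - c2) * of_real h)) =
         norm (LINT x|std_normal_distribution. A (?t x) h - P (?t x) h)"
        using intA intP P by simp
      also have "\<dots> \<le> (LINT x|std_normal_distribution. norm (A (?t x) h - P (?t x) h))"
        by (rule integral_norm_bound)
      also have "\<dots> \<le> (LINT x|std_normal_distribution. h ^ 2 * D x)"
        using elim
            by (intro integral_mono integrable_norm Bochner_Integration.integrable_diff intA intP
            integrable_mult_right intD point) auto
      finally show ?case by (simp add: mult.commute norm_power)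
    qed
  qed
qed

text \<open>From \<open>exp (h * a) \<ge> 1 + h * a\<close>. It bounds the blow-up of each Fermi
  factor by a constant times \<open>1 / h\<close>, hence that of the product by a power of
  \<open>1 / h\<close>.\<close>

lemma inverse_one_minus_exp_le:
  fixes a h :: real
  assumes "0 < a" "0 < h" "h < 1"
  shows "1 / (1 - exp (- h * a)) \<le> (1 + a) / a / h"
proof -
  have "exp (h * a) \<ge> 1 + h * a" by (rule exp_ge_add_one_self)
  then have "1 / exp (h * a) \<le> 1 / (1 + h * a)"
    using assms by (intro divide_left_mono mult_pos_pos add_pos_pos) auto
  then have "exp (- h * a) \<le> 1 / (1 + h * a)"
    by (simp add: exp_minus inverse_eq_divide)
  moreover have "1 - 1 / (1 + h * a) = h * a / (1 + h * a)"
    using assms by (simp add: field_simps add_nonneg_eq_0_iff)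
  moreover have "h * a / (1 + h * a) \<ge> h * a / (1 + a)"
    using assms by (intro divide_left_mono mult_pos_pos add_pos_pos) auto
  ultimately have "1 - exp (- h * a) \<ge> h * a / (1 + a)" by linarith
  then have "1 / (1 - exp (- h * a)) \<le> 1 / (h * a / (1 + a))"
    using assms by (intro divide_left_mono) auto
  then show ?thesis by (simp add: mult.commute)
qed

lemma empty_sum_asymp:
  assumes "finite \<Lambda>"
  shows "(\<lambda>h. complex_of_real (empty_sum h \<Lambda> 0) - of_real (1 / 2 ^ card \<Lambda> *
      (1 + ((\<Sum>l\<in>\<Lambda>. of_int l + 1/2) / 2 - real (card \<Lambda>) * (real (card \<Lambda>) - 1) / 8) * h)))
     \<in> O[at_right 0](\<lambda>h. of_real (h ^ 2))"
proof -
  define n where "n = card \<Lambda>"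
  \<comment> \<open>Large enough to move the contour past all poles at once.\<close>
  define L where "L = 1 + (\<Sum>l\<in>\<Lambda>. \<bar>real_of_int l\<bar>)"
  have L: "of_int l + 1/2 + L > 0" if "l \<in> \<Lambda>" for l
    using member_le_sum[of l \<Lambda> "\<lambda>l. \<bar>real_of_int l\<bar>"] that assms by (simp add: L_def)
  define A where "A t h
      = exp (- of_real L * t + of_real (L\<^sup>2 / 2) * of_real h) * (2 ^ n * fermi_prod L \<Lambda> t h)" for
      t h
  have exp: "expands A (- of_real L + of_real (- real n / 2))
    (of_real (L\<^sup>2 / 2) + of_real (real n * (real n - 1) / 8) + - of_real L * of_real (- real n / 2))
    (of_real (L\<^sup>2 / 2) + of_real ((\<Sum>l\<in>\<Lambda>. of_int l + 1/2 + L) / 2))"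
    unfolding A_def n_def by (intro expands_mult expands_exp expands_fermi_prod assms)
  define K where "K
      = exp (L\<^sup>2 / 2) * (2 ^ n * (\<Prod>l\<in>\<Lambda>. (1 + (of_int l + 1/2 + L)) / (of_int l + 1/2 + L)))"
  have bound: "norm (A (\<i> * of_real x) h) \<le> K / h ^ n" if h: "0 < h" "h < 1" for h x
  proof -
    have "norm (fermi_prod L \<Lambda> (\<i> * of_real x) h)
        \<le> (\<Prod>l\<in>\<Lambda>. 1 / (1 - exp (- h * (of_int l + 1/2 + L))))"
      using h L by (intro norm_fermi_prod_le) auto
    also have "\<dots> \<le> (\<Prod>l\<in>\<Lambda>. (1 + (of_int l + 1/2 + L)) / (of_int l + 1/2 + L) / h)"
    proof (intro prod_mono conjI inverse_one_minus_exp_le L h)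
      fix l assume "l \<in> \<Lambda>"
      then have "h * (of_int l + 1/2 + L) > 0" using L h by simp
      then show "0 \<le> 1 / (1 - exp (- h * (of_int l + 1/2 + L)))" by simp
    qed
    also have "\<dots> = (\<Prod>l\<in>\<Lambda>. (1 + (of_int l + 1/2 + L)) / (of_int l + 1/2 + L)) / h ^ n"
      by (simp only: prod_dividef prod_constant n_def)
    finally have 1: "norm (fermi_prod L \<Lambda> (\<i> * of_real x) h) \<le> \<dots>" .
    have "norm (exp (- of_real L * (\<i> * of_real x) + of_real (L\<^sup>2 / 2) * of_real h))
        = exp (L\<^sup>2 / 2 * h)"
      by (simp add: norm_exp_eq_Re)
    also have "\<dots> \<le> exp (L\<^sup>2 / 2)"
      using h mult_left_le[of h "L\<^sup>2 / 2"] by simp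
    finally have 2: "norm (exp (- of_real L * (\<i> * of_real x) + of_real (L\<^sup>2 / 2) * of_real h))
        \<le> exp (L\<^sup>2 / 2)" .
    have "norm (A (\<i> * of_real x) h) \<le> exp (L\<^sup>2 / 2) * (2 ^ n *
       ((\<Prod>l\<in>\<Lambda>. (1 + (of_int l + 1/2 + L)) / (of_int l + 1/2 + L)) / h ^ n))"
      unfolding A_def norm_mult norm_power norm_numeral using 1 2 by (intro mult_mono) auto
    then show ?thesis by (simp add: K_def)
  qed
  have cont: "continuous_on UNIV (\<lambda>x. A (\<i> * of_real (sqrt h * x)) h)" if "0 < h" for h
    unfolding A_def using that L by (intro continuous_intros continuous_on_fermi_prod) auto
  let ?d = "(\<Sum>l\<in>\<Lambda>. of_int l + 1/2) / 2 - real n * (real n - 1) / 8"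
  have "(\<Sum>l\<in>\<Lambda>. of_int l + 1/2 + L) = (\<Sum>l\<in>\<Lambda>. of_int l + 1/2) + real n * L"
    by (simp add: sum.distrib n_def)
  \<comment> \<open>The shift drops out: the squares cancel, and the \<open>n * L / 2\<close> from
    the sum over modes cancels the cross term of the two expansions.\<close>
  then have d: "of_real (L\<^sup>2 / 2) + of_real ((\<Sum>l\<in>\<Lambda>. of_int l + 1/2 + L) / 2) -
      (of_real (L\<^sup>2 / 2) + of_real (real n * (real n - 1) / 8)
          + - of_real L * of_real (- real n / 2)) = complex_of_real ?d"
    by (simp only:) (simp add: field_simps)
  have "(\<lambda>h. (LINT x|std_normal_distribution. A (\<i> * of_real (sqrt h * x)) h)
      - (1 + of_real ?d * of_real h))
     \<in> O[at_right 0](\<lambda>h. of_real (h ^ 2))"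
    using expands_std_normal_mean[OF exp cont bound] unfolding d .
  then have "(\<lambda>h. of_real (1 / 2 ^ n) *
      ((LINT x|std_normal_distribution. A (\<i> * of_real (sqrt h * x)) h)
      - (1 + of_real ?d * of_real h)))
     \<in> O[at_right 0](\<lambda>h. of_real (h ^ 2))"
    by simp
  moreover have "\<forall>\<^sub>F h in at_right 0. of_real (1 / 2 ^ n) *
      ((LINT x|std_normal_distribution. A (\<i> * of_real (sqrt h * x)) h)
      - (1 + of_real ?d * of_real h)) =
     complex_of_real (empty_sum h \<Lambda> 0) - of_real (1 / 2 ^ n * (1 + ?d * h))"
    using eventually_at_right_less[of 0]
  proof eventually_elim
    case (elim h)
    have "(\<lambda>x. A (\<i> * of_real (sqrt h * x)) h) = (\<lambda>x. (2 ^ n * exp (of_real (h * (L\<^sup>2 / 2)))) *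
        (exp (- of_real L * (\<i> * of_real (sqrt h * x))) * fermi_prod L \<Lambda>
            (\<i> * of_real (sqrt h * x)) h))"
      unfolding A_def exp_add by (simp add: mult_ac)
    then have "(LINT x|std_normal_distribution. A (\<i> * of_real (sqrt h * x)) h)
        = 2 ^ n * gauss_mean h L \<Lambda> 0"
      by (simp only: integral_mult_right_zero gauss_mean_def) simp
    also have "\<dots> = 2 ^ n * of_real (empty_sum h \<Lambda> 0)"
      using empty_sum_eq_gauss_mean[OF elim assms L, of 0] by simp
    finally show ?case by (simp add: right_diff_distrib distrib_left)
  qed
  ultimately show ?thesis unfolding n_def by (subst (asm) landau_o.big.in_cong)
qed

text \<open>At \<open>q = exp (- h)\<close> the complex powers are real exponentials, and the
  \<open>q powr (1/24)\<close> of \<open>eta_q\<close> cancels the shift in the trace. Only the set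
  of modes enters, because the trace condition asks that each of them be empty.\<close>

lemma (in fermionic_fock_space) npoint_coeff_eq_empty_sum:
  assumes "h > 0"
  shows "npoint_coeff n (\<lambda>j. - of_int (l j) - 1/2) (of_real (exp (- h)))
      = of_real (empty_sum h (l ` {1..n}) 0)"
proof -
  let ?q = "complex_of_real (exp (- h))"
  let ?S = "{p \<in> charge_states 0. \<forall>l\<in>l ` {1..n}. mode_empty l p}"
  have powr: "?q powr of_real a = of_real (exp (- h * a))" for a
    by (subst powr_of_real) (simp_all add: powr_def mult.commute)
  have "(\<lambda>m. complex_of_real (1 - exp (- h) ^ Suc m)) has_prod of_real (euler_phi h)"
    using euler_phi_has_prod[OF assms] by (simp only: has_prod_of_real_iff)
  then have "(\<Prod>m. 1 - ?q ^ Suc m) = of_real (euler_phi h)"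
    by (simp add: has_prod_iff)
  then have eta: "eta_q ?q = of_real (exp (- h / 24) * euler_phi h)"
    using powr[of "1/24"] by (simp add: eta_q_def)
  have "(\<Sum>\<^sub>\<infinity>p\<in>?S. ?q powr of_real (fock_energy p - 1/24))
      = (\<Sum>\<^sub>\<infinity>p\<in>?S. of_real (exp (h / 24) * boltzmann h p))"
    unfolding powr boltzmann_def by (simp add: algebra_simps flip: exp_add)
  also have "\<dots> = of_real (exp (h / 24) * infsum (boltzmann h) ?S)"
    using boltzmann_summable[OF assms, of ?S 0]
    by (intro infsumI has_sum_of_real has_sum_cmult_right has_sum_infsum) auto
  finally have *: "(\<Sum>\<^sub>\<infinity>p\<in>?S. ?q powr of_real (fock_energy p - 1/24)) = \<dots>" .
  have "npoint_coeff n (\<lambda>j. - of_int (l j) - 1/2) ?q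
      = eta_q ?q * (\<Sum>\<^sub>\<infinity>p\<in>?S. ?q powr of_real (fock_energy p - 1/24))"
    unfolding npoint_coeff_eq by (simp add: charge_states_def conj_assoc)
  also have "\<dots>
      = of_real ((exp (- h / 24) * exp (h / 24)) * (euler_phi h * infsum (boltzmann h) ?S))"
    unfolding * eta by (simp only: of_real_mult mult_ac)
  also have "exp (- h / 24) * exp (h / 24) = 1" by (simp flip: exp_add)
  finally show ?thesis by (simp add: empty_sum_def)
qed

theorem corollary1p3:
  fixes scale :: "complex \<Rightarrow> 'v::ab_group_add \<Rightarrow> 'v"
    and psi psis :: "int \<Rightarrow> 'v \<Rightarrow> 'v" and vac :: 'v
    and n m :: nat and r s :: "nat \<Rightarrow> nat"
  assumes "fermionic_fock_space scale psi psis vac"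
    and "n \<ge> 1" and "m \<le> n"
    and "\<And>j k. 1 \<le> j \<Longrightarrow> j < k \<Longrightarrow> k \<le> m \<Longrightarrow> r j > r k"
    and "\<And>j k. m + 1 \<le> j \<Longrightarrow> j < k \<Longrightarrow> k \<le> n \<Longrightarrow> s j > s k"
    and "\<And>j k. j \<in> {1..m} \<Longrightarrow> k \<in> {m+1..n} \<Longrightarrow> - real (r j) - 1/2 \<noteq> real (s k) + 1/2"
  shows "(\<lambda>y::real.
      fermionic_fock_space.G_coeff scale psi psis vac n m r s (complex_of_real (exp (- 2 * pi * y)))
      - complex_of_real (1 / 2 ^ n *
          (1 - pi * (real (\<Sum>k=1..m. r k) - real (\<Sum>k=m+1..n. s k) + real m
                       + real n * (real n - 3) / 4) * y)))
    \<in> O[at_right 0](\<lambda>y. complex_of_real (y ^ 2))"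
proof -
  interpret fermionic_fock_space scale psi psis vac by fact
  \<comment> \<open>The mode belonging to the exponent \<open>x\<close> is
    \<open>- x - 1/2\<close>.\<close>
  define l where "l j = (if j \<le> m then - int (r j) - 1 else int (s j))" for j
  \<comment> \<open>The modes are negative up to index \<open>m\<close> and nonnegative beyond it;
    within each range strict monotonicity separates them.\<close>
  have inj: "inj_on l {1..n}"
  proof (rule linorder_inj_onI)
    fix j k assume "j < k" "j \<in> {1..n}" "k \<in> {1..n}"
    then show "l j \<noteq> l k" using assms(4)[of j k] assms(5)[of j k] by (auto simp: l_def)
  qed auto
  then have card: "card (l ` {1..n}) = n" by (simp add: card_image)
  have split: "{1..n} = {1..m} \<union> {m+1..n}" using assms(3) by auto
  have "(\<Sum>k\<in>l ` {1..n}. of_int k + 1/2) = (\<Sum>j\<in>{1..n}. real_of_int (l j) + 1/2)"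
    using inj by (simp add: sum.reindex)
  also have "\<dots> = (\<Sum>j=1..m. real_of_int (l j) + 1/2) + (\<Sum>j=m+1..n. real_of_int (l j) + 1/2)"
    unfolding split by (rule sum.union_disjoint) auto
  also have "(\<Sum>j=1..m. real_of_int (l j) + 1/2) = (\<Sum>j=1..m. - real (r j) - 1/2)"
    by (intro sum.cong) (auto simp: l_def)
  also have "\<dots> = - real (\<Sum>k=1..m. r k) - real m / 2"
    by (simp add: sum_subtractf sum_negf)
  also have "(\<Sum>j=m+1..n. real_of_int (l j) + 1/2) = (\<Sum>j=m+1..n. real (s j) + 1/2)"
    by (intro sum.cong) (auto simp: l_def)
  also have "\<dots> = real (\<Sum>k=m+1..n. s k) + (real n - real m) / 2"
    using assms(3) by (simp add: sum.distrib of_nat_diff)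
  finally have sum: "(\<Sum>k\<in>l ` {1..n}. of_int k + 1/2) =
      real (\<Sum>k=m+1..n. s k) - real (\<Sum>k=1..m. r k) - real m + real n / 2"
    by (simp add: field_simps)
  have G: "G_coeff n m r s (of_real (exp (- h)))
      = of_real (empty_sum h (l ` {1..n}) 0)" if "h > 0" for h
  proof -
    have "(\<lambda>j. if j \<le> m then real (r j) + 1/2 else - real (s j) - 1/2) = (\<lambda>j. - of_int (l j) - 1/2)"
      by (auto simp: l_def)
    then show ?thesis unfolding G_coeff_def using npoint_coeff_eq_empty_sum[OF that, of n l] by simp
  qed
  have lim: "filterlim (\<lambda>y::real. 2 * pi * y) (at_right 0) (at_right 0)"
    unfolding filterlim_at
    by (auto intro!: tendsto_eq_intros eventually_at_right_less simp: eventually_at_filter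
        zero_less_mult_iff)
  have "(\<lambda>y. complex_of_real (empty_sum (2 * pi * y) (l ` {1..n}) 0) - of_real (1 / 2 ^ n *
      (1 + ((\<Sum>l\<in>l ` {1..n}. of_int l + 1/2) / 2 - real n * (real n - 1) / 8) * (2 * pi * y))))
     \<in> O[at_right 0](\<lambda>y. of_real ((2 * pi * y) ^ 2))"
    using landau_o.big.compose[OF empty_sum_asymp[of "l ` {1..n}"] lim] unfolding card by simp
  also have "(\<lambda>y. complex_of_real ((2 * pi * y) ^ 2)) \<in> O[at_right 0](\<lambda>y. of_real (y ^ 2))"
    by (simp add: power_mult_distrib)
  finally have main: "(\<lambda>y. complex_of_real (empty_sum (2 * pi * y) (l ` {1..n}) 0)
      - of_real (1 / 2 ^ n *
      (1 + ((\<Sum>l\<in>l ` {1..n}. of_int l + 1/2) / 2 - real n * (real n - 1) / 8) * (2 * pi * y))))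
     \<in> O[at_right 0](\<lambda>y. of_real (y ^ 2))" .
  \<comment> \<open>With \<open>h = 2 * pi * y\<close>, the \<open>n / 2\<close> in the sum over
    modes combines with \<open>- n * (n - 1) / 4\<close> to give
    \<open>- n * (n - 3) / 4\<close>.\<close>
  have coeff: "1
      + ((\<Sum>l\<in>l ` {1..n}. of_int l + 1/2) / 2 - real n * (real n - 1) / 8) * (2 * pi * y) =
     1 - pi * (real (\<Sum>k=1..m. r k) - real (\<Sum>k=m+1..n. s k) + real m
         + real n * (real n - 3) / 4) * y" for y
    unfolding sum by (simp add: field_simps)
  have "\<forall>\<^sub>F y in at_right 0. complex_of_real (empty_sum (2 * pi * y) (l ` {1..n}) 0)
      = G_coeff n m r s (of_real (exp (- 2 * pi * y)))"
    using eventually_at_right_less[of "0::real"]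
  proof eventually_elim
    case (elim y)
    then show ?case using G[of "2 * pi * y"] by simp
  qed
  then show ?thesis
    using main unfolding coeff
    by (elim landau_o.big.in_cong[THEN iffD1, rotated]) (simp add: eventually_mono)
qed

end
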